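(* Let $n>1$ and $k\ge 1$ be integers, let $0=\alpha_0<\alpha_1<\cdots<\alpha_{n-1}<\alpha_n=2\pi$, let $D\subset\mathbb{R}_+$ be an open bounded interval and let $\varepsilon_0>0$. For $j=1,\dots,n$ and $i=0,1,\dots,k$ let $F_i^j:\mathbb{S}^1\times D\to\mathbb{R}$ and $R^j:\mathbb{R}\times D\times(-\varepsilon_0,\varepsilon_0)\to\mathbb{R}$ be $C^{k+1}$ functions, $2\pi$-periodic in the first variable, where $\mathbb{S}^1=\mathbb{R}/2\pi\mathbb{Z}$. Consider the discontinuous piecewise differential equation $$r'(\theta)=\sum_{i=0}^k\varepsilon^iF_i(\theta,r)+\varepsilon^{k+1}R(\theta,r,\varepsilon),\qquad (\ast)$$ with $F_i(\theta,r)=\sum_{j=1}^n\chi_{[\alpha_{j-1},\alpha_j]}(\theta)F_i^j(\theta,r)$ and $R(\theta,r,\varepsilon)=\sum_{j=1}^n\chi_{[\alpha_{j-1},\alpha_j]}(\theta)R^j(\theta,r,\varepsilon)$. For $\rho\in D$ let $\varphi(\cdot,\rho)$ be the solution of the unperturbed equation $r'(\theta)=F_0(\theta,r)$ with $\varphi(0,\rho)=\rho$, and assume that for every $\rho\in D$ this solution is defined for all $\theta\in\mathbb{S}^1$, reaches the discontinuity set only at crossing points, and is $2\pi$-periodic in $\theta$. Let $f_1,\dots,f_k:D\to\mathbb{R}$ be the averaged functions of $(\ast)$ (defined in the context). Assume that for some $l\in\{1,2,\dots,k\}$ we have $f_s\equiv 0$ on $D$ for $s=1,2,\dots,l-1$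 and $f_l\not\equiv 0$. If there exists $\rho^*\in D$ such that $f_l(\rho^* )=0$ and $f_l'(\rho^* )\neq 0$, then for $|\varepsilon|\neq 0$ sufficiently small there exists a $2\pi$-periodic solution $r(\theta,\varepsilon)$ of $(\ast)$ such that $r(0,\varepsilon)\to\rho^*$ as $\varepsilon\to 0$.
   Context: $\chi_A$ is the characteristic function of the interval $A$ (equal to $1$ on $A$ and $0$ off $A$); the angle $\theta$ is taken in $[0,2\pi]$ and everything is extended $2\pi$-periodically. The discontinuity set is $\{\theta=\alpha_j\}$, $j=0,\dots,n-1$, in $\mathbb{S}^1\times D$. A solution of $(\ast)$ (or of the unperturbed equation $r'=F_0(\theta,r)$) on $[0,2\pi]$ is a continuous function which, on each interval $[\alpha_{j-1},\alpha_j]$, solves the smooth equation $r'=\sum_{i=0}^k\varepsilon^iF_i^j(\theta,r)+\varepsilon^{k+1}R^j(\theta,r,\varepsilon)$ (respectively $r'=F_0^j(\theta,r)$), i.e. solutions are concatenated across the discontinuity set (crossing). A solution is $2\pi$-periodic if it takes the same value at $\theta=0$ and $\theta=2\pi$, so that it extends $2\pi$-periodically. For a function $G(\theta,r)$, $\partial^LG$ denotes its derivative of order $L$ with respect to the second variable $r$, with $\partial^L F_i(\theta,r):=\sum_{j=1}^n\chi_{[\alpha_{j-1},\alpha_j]}(\theta)\,\partial^LF_i^j(\theta,r)$. For $l\ge 1$, $S_l$ is the set of all $l$-tuples of non-negative integers $(b_1,\dots,b_l)$ with $b_1+2b_2+\cdots+lb_l=l$, and for such a tuple $L=b_1+b_2+\cdots+b_l$.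 The averaged functions are $f_i(\rho)=\dfrac{y_i(2\pi,\rho)}{i!}$, $i=1,\dots,k$, where the functions $y_i(\theta,\rho)$, for $\theta\in[0,2\pi]$ and $\rho\in D$, are defined recurrently as the continuous (in $\theta$) solutions of the integral equations $$y_1(\theta,\rho)=\int_0^\theta\Big(F_1(s,\varphi(s,\rho))+\partial F_0(s,\varphi(s,\rho))\,y_1(s,\rho)\Big)ds,$$ $$y_i(\theta,\rho)=i!\int_0^\theta\Big(F_i(s,\varphi(s,\rho))+\sum_{l=1}^{i}\sum_{S_l}\frac{1}{b_1!\,b_2!2!^{b_2}\cdots b_l!l!^{b_l}}\,\partial^LF_{i-l}(s,\varphi(s,\rho))\prod_{m=1}^{l}y_m(s,\rho)^{b_m}\Big)ds,\quad i=2,\dots,k.$$ *)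

theory Defs
  imports "HOL-Analysis.Analysis"
begin

text \<open>
  \<open>Ck m f S\<close>: the map \<open>f\<close> is of class \<open>C\<^sup>m\<close> on \<open>S\<close> (meant for open \<open>S\<close>).
  In finite dimension, asking every directional component \<open>x \<mapsto> Df(x) v\<close> to be \<open>C\<^sup>m\<close> is the same
  as asking \<open>x \<mapsto> Df(x)\<close> to be \<open>C\<^sup>m\<close>.
\<close>

primrec Ck :: "nat \<Rightarrow> ('a::euclidean_space \<Rightarrow> 'b::real_normed_vector) \<Rightarrow> 'a set \<Rightarrow> bool" where
  "Ck 0 f S \<longleftrightarrow> continuous_on S f"
| "Ck (Suc m) f S \<longleftrightarrow>
     (\<forall>x\<in>S. f differentiable (at x)) \<and> (\<forall>v. Ck m (\<lambda>x. frechet_derivative f (at x) v) S)"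

text \<open>
  Zones are numbered \<open>j = 1..n\<close>, zone \<open>j\<close> being \<open>[\<alpha> (j-1), \<alpha> j]\<close>. A family
  \<open>G :: nat \<Rightarrow> real \<Rightarrow> real \<Rightarrow> real\<close> stores one function \<open>G j \<theta> r\<close> per zone. The angle is a real
  number; functions on the circle are \<open>2\<pi>\<close>-periodic functions of a real variable.
\<close>

definition piecewise :: "nat \<Rightarrow> (nat \<Rightarrow> real) \<Rightarrow> (nat \<Rightarrow> real \<Rightarrow> real \<Rightarrow> real) \<Rightarrow> real \<Rightarrow> real \<Rightarrow> real" where
  "piecewise n \<alpha> G \<theta> r = (\<Sum>j = 1..n. indicator {\<alpha> (j - 1)..\<alpha> j} \<theta> * G j \<theta> r)"

text \<open>
  A solution is concatenated from solutions in the zones; at the zone ends the derivative is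
  one-sided, so that it may jump there. The solution has to stay in \<open>D\<close>, where the equation lives.
\<close>

definition pw_solution ::
  "nat \<Rightarrow> (nat \<Rightarrow> real) \<Rightarrow> real set \<Rightarrow> (nat \<Rightarrow> real \<Rightarrow> real \<Rightarrow> real) \<Rightarrow> (real \<Rightarrow> real) \<Rightarrow> bool" where
  "pw_solution n \<alpha> D G r \<longleftrightarrow>
     continuous_on {0..2 * pi} r \<and>
     (\<forall>\<theta>\<in>{0..2 * pi}. r \<theta> \<in> D) \<and>
     (\<forall>j\<in>{1..n}. \<forall>\<theta>\<in>{\<alpha> (j - 1)..\<alpha> j}.
        (r has_real_derivative G j \<theta> (r \<theta>)) (at \<theta> within {\<alpha> (j - 1)..\<alpha> j}))"

definition periodic_solution ::
  "nat \<Rightarrow> (nat \<Rightarrow> real) \<Rightarrow> real set \<Rightarrow> (nat \<Rightarrow> real \<Rightarrow> real \<Rightarrow> real) \<Rightarrow> (real \<Rightarrow> real) \<Rightarrow> bool" where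
  "periodic_solution n \<alpha> D G r \<longleftrightarrow> pw_solution n \<alpha> D G r \<and> r 0 = r (2 * pi)"

text \<open>
  Filippov's crossing condition at the point \<open>(\<alpha> j, r)\<close>, \<open>j = 0..n-1\<close>: with \<open>h(\<theta>,r) = \<theta> - \<alpha> j\<close>, whose
  gradient is \<open>(1,0)\<close>, the Lie derivatives of \<open>h\<close> along the two adjacent vector fields of the
  autonomous system \<open>\<theta>' = 1, r' = G(\<theta>,r)\<close> have the same sign. The zone preceding \<open>\<alpha> 0 = 0\<close> on the
  circle is zone \<open>n\<close>. Since \<open>\<theta>' = 1\<close>, the condition always holds for such systems.
\<close>

definition crossing_point ::
  "nat \<Rightarrow> (nat \<Rightarrow> real) \<Rightarrow> (nat \<Rightarrow> real \<Rightarrow> real \<Rightarrow> real) \<Rightarrow> nat \<Rightarrow> real \<Rightarrow> bool" where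
  "crossing_point n \<alpha> G j r \<longleftrightarrow>
     (let Xminus = (1, G (if j = 0 then n else j) (\<alpha> j) r) :: real \<times> real;
          Xplus = (1, G (Suc j) (\<alpha> j) r) :: real \<times> real
      in (Xminus \<bullet> (1, 0)) * (Xplus \<bullet> (1, 0)) > 0)"

text \<open>The right-hand side of the perturbed equation in each zone.\<close>

definition perturbed_field ::
  "nat \<Rightarrow> (nat \<Rightarrow> nat \<Rightarrow> real \<Rightarrow> real \<Rightarrow> real) \<Rightarrow> (nat \<Rightarrow> real \<Rightarrow> real \<Rightarrow> real \<Rightarrow> real) \<Rightarrow>
     real \<Rightarrow> nat \<Rightarrow> real \<Rightarrow> real \<Rightarrow> real" where
  "perturbed_field k F R \<epsilon> j \<theta> r =
     (\<Sum>i = 0..k. \<epsilon> ^ i * F i j \<theta> r) + \<epsilon> ^ (k + 1) * R j \<theta> r \<epsilon>"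

text \<open>
  \<open>pw_deriv n \<alpha> (F i) L\<close> is \<open>\<partial>\<^sup>L F\<^sub>i\<close>, the piecewise \<open>L\<close>-th derivative in the second variable.
\<close>

definition pw_deriv ::
  "nat \<Rightarrow> (nat \<Rightarrow> real) \<Rightarrow> (nat \<Rightarrow> real \<Rightarrow> real \<Rightarrow> real) \<Rightarrow> nat \<Rightarrow> real \<Rightarrow> real \<Rightarrow> real" where
  "pw_deriv n \<alpha> G L = piecewise n \<alpha> (\<lambda>j \<theta>. (deriv ^^ L) (G j \<theta>))"

text \<open>Tuples \<open>(b\<^sub>1, \<dots>, b\<^sub>l)\<close> are functions on \<open>{1..l}\<close>, \<open>undefined\<close> elsewhere.\<close>

definition S_tuples :: "nat \<Rightarrow> (nat \<Rightarrow> nat) set" where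
  "S_tuples l = {b \<in> {1..l} \<rightarrow>\<^sub>E UNIV. (\<Sum>m = 1..l. m * b m) = l}"

lemma finite_S_tuples: "finite (S_tuples l)"
proof (rule finite_subset)
  show "S_tuples l \<subseteq> {1..l} \<rightarrow>\<^sub>E {..l}"
  proof
    fix b assume b: "b \<in> S_tuples l"
    have "b m \<le> l" if m: "m \<in> {1..l}" for m
    proof -
      have "b m \<le> m * b m" using m by simp
      also have "\<dots> \<le> (\<Sum>m = 1..l. m * b m)" using m by (intro member_le_sum) auto
      also have "\<dots> = l" using b by (simp add: S_tuples_def)
      finally show ?thesis .
    qed
    with b show "b \<in> {1..l} \<rightarrow>\<^sub>E {..l}" by (auto simp: S_tuples_def PiE_iff)
  qed
qed (auto intro: finite_PiE)

text \<open>
  The functions \<open>y i \<theta> \<rho>\<close>, \<open>i = 1..k\<close>, as continuous solutions of the recurrent integral equations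
  along the unperturbed solutions \<open>\<phi> \<theta> \<rho>\<close>. These determine \<open>y i \<theta> \<rho>\<close> uniquely for \<open>\<theta>\<close> in
  \<open>[0, 2\<pi>]\<close> and \<open>\<rho>\<close> in \<open>D\<close>.
\<close>

definition averaging_system ::
  "nat \<Rightarrow> nat \<Rightarrow> (nat \<Rightarrow> real) \<Rightarrow> real set \<Rightarrow> (nat \<Rightarrow> nat \<Rightarrow> real \<Rightarrow> real \<Rightarrow> real) \<Rightarrow>
     (real \<Rightarrow> real \<Rightarrow> real) \<Rightarrow> (nat \<Rightarrow> real \<Rightarrow> real \<Rightarrow> real) \<Rightarrow> bool" where
  "averaging_system n k \<alpha> D F \<phi> y \<longleftrightarrow>
     (\<forall>\<rho>\<in>D.
        (\<forall>i\<in>{1..k}. continuous_on {0..2 * pi} (\<lambda>\<theta>. y i \<theta> \<rho>)) \<and>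
        (\<forall>\<theta>\<in>{0..2 * pi}.
           y 1 \<theta> \<rho> = integral {0..\<theta>} (\<lambda>s.
             piecewise n \<alpha> (F 1) s (\<phi> s \<rho>) + pw_deriv n \<alpha> (F 0) 1 s (\<phi> s \<rho>) * y 1 s \<rho>)) \<and>
        (\<forall>i\<in>{2..k}. \<forall>\<theta>\<in>{0..2 * pi}.
           y i \<theta> \<rho> = fact i * integral {0..\<theta>} (\<lambda>s.
             piecewise n \<alpha> (F i) s (\<phi> s \<rho>) +
             (\<Sum>l = 1..i. \<Sum>b \<in> S_tuples l.
                1 / (\<Prod>m = 1..l. fact (b m) * fact m ^ b m) *
                pw_deriv n \<alpha> (F (i - l)) (\<Sum>m = 1..l. b m) s (\<phi> s \<rho>) *
                (\<Prod>m = 1..l. y m s \<rho> ^ b m)))))"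

definition averaged :: "(nat \<Rightarrow> real \<Rightarrow> real \<Rightarrow> real) \<Rightarrow> nat \<Rightarrow> real \<Rightarrow> real" where
  "averaged y i \<rho> = y i (2 * pi) \<rho> / fact i"

end

theory Submission
  imports Defs
begin

text \<open>
  For fixed \<open>\<rho>\<close> the polynomial \<open>p(\<theta>) = \<phi>(\<theta>,\<rho>) + \<Sum>\<^sub>i \<epsilon>\<^sup>i y\<^sub>i(\<theta>,\<rho>) / i!\<close> solves the perturbed equation up to an
  error \<open>O(\<epsilon>\<^bsup>k+1\<^esup>)\<close>, because the recurrence for \<open>y\<^sub>i\<close> consists of the Taylor coefficients of the field
  along \<open>p\<close>. Gronwall's inequality in integral form ignores the jumps in \<open>\<theta>\<close> and yields
  \<open>r(2\<pi>) - \<rho> = \<epsilon>\<^sup>l f\<^sub>l(\<rho>) + O(\<epsilon>\<^bsup>l+1\<^esup>)\<close>, pointwise in \<open>\<rho>\<close>. As \<open>f\<^sub>l\<close> changes sign at \<open>\<rho>\<^sup>*\<close>, so does the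
  displacement function between two points close to \<open>\<rho>\<^sup>*\<close>, and the intermediate value theorem
  replaces the implicit function theorem: only continuous dependence on \<open>\<rho>\<close> is needed.
\<close>

section \<open>Integral equations\<close>

text \<open>Expanding pointwise is enough because the sign change is read off at only two initial
  radii, both fixed before \<epsilon>. The error constants may depend on the radius, and no
  regularity of the \<open>y i\<close> in \<rho> enters. Three obstacles shape the rest. The
  equation lives only in \<open>D\<close>, so existence over a full turn and uniform constants both
  need a compact interval that contains the relevant orbits with a margin; the deviations of order
  \<epsilon> are paid from that margin. The recurrence differentiates zone-wise sums, sums over
  tuples of fixed weight and states order 1 separately, whereas Taylor's theorem works in a single
  zone and produces powers of a polynomial in \<epsilon>; the Faa di Bruno lemmas reconcile the two.
  Finally, the intermediate value theorem gives a separate threshold on \<epsilon> for each distance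
  to the zero, and a solution that need not be unique, so one convergent family still has to be
  selected.\<close>

lemma gronwall:
  fixes u :: "real \<Rightarrow> real"
  assumes cont: "continuous_on {0..T} u" and "L \<ge> 0"
    and le: "\<And>t. t \<in> {0..T} \<Longrightarrow> u t \<le> A + L * integral {0..t} u"
    and t: "t \<in> {0..T}"
  shows "u t \<le> A * exp (L * t)"
proof -
  \<comment> \<open>Integrating factor: \<open>w\<close> is the assumed bound divided by
    \<open>exp (L * s)\<close>. Its derivative has the sign of \<open>u\<close> minus that bound, so
    \<open>w\<close> never exceeds \<open>w 0 = A\<close>.\<close>
  define w where "w s = exp (- L * s) * (A + L * integral {0..s} u)" for s
  have w': "(w has_real_derivative exp (- L * s) * L * (u s - (A + L * integral {0..s} u))) (at s within {0..T})"
    if "s \<in> {0..T}" for s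
    unfolding w_def
    by (rule derivative_eq_intros integral_has_real_derivative[OF cont that] refl)+
      (simp add: algebra_simps)
  have "w t \<le> w 0"
  proof (rule DERIV_nonpos_imp_decreasing_open[of 0 t w])
    show "0 \<le> t" using t by simp
    show "\<exists>y. (w has_real_derivative y) (at s) \<and> y \<le> 0" if "0 < s" "s < t" for s
    proof (intro exI conjI)
      have s: "s \<in> {0..T}" "0 < s" "s < T" using that t by auto
      show "(w has_real_derivative exp (- L * s) * L * (u s - (A + L * integral {0..s} u))) (at s)"
        using w'[OF s(1)] unfolding at_within_Icc_at[OF s(2,3)] .
      show "exp (- L * s) * L * (u s - (A + L * integral {0..s} u)) \<le> 0"
        using le[OF s(1)] \<open>L \<ge> 0\<close> by (intro mult_nonneg_nonpos) auto
    qed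
    have "continuous_on {0..T} w"
      using w' by (rule DERIV_continuous_on)
    then show "continuous_on {0..t} w"
      by (rule continuous_on_subset) (use t in auto)
  qed
  then have "A + L * integral {0..t} u \<le> A * exp (L * t)"
    by (simp add: w_def exp_minus field_simps)
  with le[OF t] show ?thesis by simp
qed

text \<open>The integrands need only be integrable, so jumps in the angle do no harm, and
  \<open>g\<close> need not be a field evaluated along \<open>p\<close>: any defect goes into
  \<eta>. The three uses are the distance to an approximate solution, the distance to the
  unperturbed orbit, and Lipschitz dependence on the initial radius.\<close>

lemma integral_equation_comparison:
  fixes x p f g :: "real \<Rightarrow> real"
  assumes x: "\<And>t. t \<in> {0..T} \<Longrightarrow> x t = x0 + integral {0..t} f"
    and p: "\<And>t. t \<in> {0..T} \<Longrightarrow> p t = p0 + integral {0..t} g"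
    and f: "f integrable_on {0..T}" and g: "g integrable_on {0..T}"
    and "continuous_on {0..T} x" "continuous_on {0..T} p"
    and le: "\<And>s. s \<in> {0..T} \<Longrightarrow> \<bar>f s - g s\<bar> \<le> L * \<bar>x s - p s\<bar> + \<eta>"
    and "L \<ge> 0" "\<eta> \<ge> 0" and t: "t \<in> {0..T}"
  shows "\<bar>x t - p t\<bar> \<le> (\<bar>x0 - p0\<bar> + \<eta> * T) * exp (L * t)"
proof (rule gronwall[OF _ \<open>L \<ge> 0\<close> _ t])
  show cont: "continuous_on {0..T} (\<lambda>s. \<bar>x s - p s\<bar>)"
    by (intro continuous_intros assms)
  fix t assume t: "t \<in> {0..T}"
  have sub: "{0..t} \<subseteq> {0..T}" using t by auto
  have int: "f integrable_on {0..t}" "g integrable_on {0..t}"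
    using f g sub by (auto intro: integrable_on_subinterval)
  have cont_t: "continuous_on {0..t} (\<lambda>s. \<bar>x s - p s\<bar>)"
    using cont sub by (rule continuous_on_subset)
  have int_u: "(\<lambda>s. \<bar>x s - p s\<bar>) integrable_on {0..t}"
    using cont_t by (rule integrable_continuous_interval)
  have int_u': "(\<lambda>s. L * \<bar>x s - p s\<bar> + \<eta>) integrable_on {0..t}"
    by (intro integrable_continuous_interval continuous_intros cont_t)
  have "\<bar>integral {0..t} (\<lambda>s. f s - g s)\<bar> \<le> integral {0..t} (\<lambda>s. L * \<bar>x s - p s\<bar> + \<eta>)"
    unfolding real_norm_def [symmetric]
    by (rule integral_norm_bound_integral) (use int int_u' le sub in \<open>auto intro: integrable_diff\<close>)
  also have "\<dots> = L * integral {0..t} (\<lambda>s. \<bar>x s - p s\<bar>) + \<eta> * t"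
    using t int_u by (subst integral_add) (auto intro!: integrable_on_mult_right)
  finally have "\<bar>integral {0..t} (\<lambda>s. f s - g s)\<bar> \<le> L * integral {0..t} (\<lambda>s. \<bar>x s - p s\<bar>) + \<eta> * T"
    using t \<open>\<eta> \<ge> 0\<close> by (smt (verit) atLeastAtMost_iff mult_left_mono)
  moreover have "x t - p t = (x0 - p0) + integral {0..t} (\<lambda>s. f s - g s)"
    using x[OF t] p[OF t] integral_diff[OF int] by simp
  ultimately show "\<bar>x t - p t\<bar> \<le> \<bar>x0 - p0\<bar> + \<eta> * T + L * integral {0..t} (\<lambda>s. \<bar>x s - p s\<bar>)"
    by linarith
qed

text \<open>The weight \<open>exp (- K t)\<close> with \<open>K > 2 \<bar>L\<bar>\<close> makes the Picard operator a contraction on the whole interval.\<close>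

lemma picard_integral_equation:
  fixes G :: "real \<Rightarrow> real \<Rightarrow> real"
  assumes "T \<ge> 0"
    and int: "\<And>x. continuous_on {0..T} x \<Longrightarrow> (\<lambda>s. G s (x s)) integrable_on {0..T}"
    and lip: "\<And>s a b. s \<in> {0..T} \<Longrightarrow> \<bar>G s a - G s b\<bar> \<le> L * \<bar>a - b\<bar>"
  obtains x where "continuous_on {0..T} x"
    and "\<And>t. t \<in> {0..T} \<Longrightarrow> x t = x0 + integral {0..t} (\<lambda>s. G s (x s))"
proof -
  define K where "K = 2 * \<bar>L\<bar> + 2"
  have K: "K > 0" "\<bar>L\<bar> / K \<le> 1 / 2" by (auto simp: K_def field_simps)
  have lip': "\<bar>G s a - G s b\<bar> \<le> \<bar>L\<bar> * \<bar>a - b\<bar>" if "s \<in> {0..T}" for s a b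
    using lip[OF that, of a b] by (smt (verit) mult_right_mono)
  \<comment> \<open>Bounded continuous functions are defined on the whole line, so time is clamped:
    outside \<open>{0..T}\<close> the iterates keep their boundary values.\<close>
  define c where "c t = max 0 (min T t)" for t :: real
  have c: "c t \<in> {0..T}" for t using \<open>T \<ge> 0\<close> by (auto simp: c_def)
  have c_id: "c t = t" if "t \<in> {0..T}" for t using that by (auto simp: c_def)
  have c_cont: "continuous_on UNIV c" unfolding c_def by (intro continuous_intros)
  \<comment> \<open>The unknown is \<open>u t = exp (- K * t) * x t\<close>, which turns the
    weighted norm of \<open>x\<close> into the plain sup norm of \<open>u\<close>.\<close>
  define I where "I u t = exp (- K * t) * (x0 + integral {0..t} (\<lambda>s. G s (exp (K * s) * apply_bcontfun u s)))" 
    for u :: "real \<Rightarrow>\<^sub>C real" and t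
  have int_u: "(\<lambda>s. G s (exp (K * s) * apply_bcontfun u s)) integrable_on {0..T}" for u :: "real \<Rightarrow>\<^sub>C real"
    by (intro int continuous_intros continuous_on_apply_bcontfun)
  have I_cont: "continuous_on {0..T} (I u)" for u
    unfolding I_def by (intro continuous_intros indefinite_integral_continuous_1 int_u)
  have Ic: "(\<lambda>t. I u (c t)) \<in> bcontfun" for u
  proof -
    have 1: "continuous_on UNIV (\<lambda>t. I u (c t))"
      by (rule continuous_on_compose2[OF I_cont c_cont]) (use c in auto)
    have "bounded (I u ` {0..T})"
      by (intro compact_imp_bounded compact_continuous_image I_cont) auto
    then have "bounded (range (\<lambda>t. I u (c t)))"
      by (rule bounded_subset) (use c in auto)
    with 1 show ?thesis by (simp add: bcontfun_def)
  qed
  define P where "P u = Bcontfun (\<lambda>t. I u (c t))" for u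
  have P: "apply_bcontfun (P u) t = I u (c t)" for u t
    unfolding P_def using Ic by (simp add: Bcontfun_inverse)
  have "dist (P u) (P v) \<le> 1 / 2 * dist u v" for u v
  proof (rule dist_bound)
    fix \<theta> :: real
    define t where "t = c \<theta>"
    have t: "t \<in> {0..T}" using c by (simp add: t_def)
    then have sub: "{0..t} \<subseteq> {0..T}" by auto
    have d: "\<bar>apply_bcontfun u s - apply_bcontfun v s\<bar> \<le> dist u v" for s
      using dist_bounded[of u s v] by (simp add: dist_real_def)
    have int_t: "(\<lambda>s. G s (exp (K * s) * apply_bcontfun u s)) integrable_on {0..t}" for u :: "real \<Rightarrow>\<^sub>C real"
      by (rule integrable_on_subinterval[OF int_u sub])
    have FTC: "((\<lambda>s. \<bar>L\<bar> * dist u v * exp (K * s)) has_integral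
        (\<bar>L\<bar> * dist u v / K * exp (K * t) - \<bar>L\<bar> * dist u v / K * exp (K * 0))) {0..t}"
      using t K(1) by (intro fundamental_theorem_of_calculus)
        (auto intro!: derivative_eq_intros simp flip: has_real_derivative_iff_has_vector_derivative)
    have "norm (integral {0..t} (\<lambda>s. G s (exp (K * s) * apply_bcontfun u s) - G s (exp (K * s) * apply_bcontfun v s)))
       \<le> integral {0..t} (\<lambda>s. \<bar>L\<bar> * dist u v * exp (K * s))"
    proof (rule integral_norm_bound_integral)
      show "(\<lambda>s. G s (exp (K * s) * apply_bcontfun u s) - G s (exp (K * s) * apply_bcontfun v s)) integrable_on {0..t}"
        by (intro integrable_diff int_t)
      show "(\<lambda>s. \<bar>L\<bar> * dist u v * exp (K * s)) integrable_on {0..t}"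
        using FTC by blast
      fix s assume "s \<in> {0..t}"
      then have "\<bar>G s (exp (K * s) * apply_bcontfun u s) - G s (exp (K * s) * apply_bcontfun v s)\<bar>
        \<le> \<bar>L\<bar> * \<bar>exp (K * s) * apply_bcontfun u s - exp (K * s) * apply_bcontfun v s\<bar>"
        using sub by (intro lip') auto
      also have "\<dots> = \<bar>L\<bar> * (exp (K * s) * \<bar>apply_bcontfun u s - apply_bcontfun v s\<bar>)"
        by (simp only: right_diff_distrib [symmetric] abs_mult abs_exp_cancel)
      also have "\<dots> \<le> \<bar>L\<bar> * (exp (K * s) * dist u v)"
        by (intro mult_left_mono d) auto
      finally show "norm (G s (exp (K * s) * apply_bcontfun u s) - G s (exp (K * s) * apply_bcontfun v s))
         \<le> \<bar>L\<bar> * dist u v * exp (K * s)"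
        by (simp only: real_norm_def mult.assoc mult.commute [of "dist u v"])
    qed
    also have "\<dots> = \<bar>L\<bar> * dist u v / K * exp (K * t) - \<bar>L\<bar> * dist u v / K"
      using integral_unique[OF FTC] by simp
    also have "\<dots> \<le> \<bar>L\<bar> / K * dist u v * exp (K * t)"
      using K(1) by simp
    also have "\<dots> \<le> 1 / 2 * dist u v * exp (K * t)"
      by (intro mult_right_mono K(2)) auto
    finally have *: "\<bar>integral {0..t} (\<lambda>s. G s (exp (K * s) * apply_bcontfun u s) - G s (exp (K * s) * apply_bcontfun v s))\<bar>
      \<le> 1 / 2 * dist u v * exp (K * t)" by simp
    have "I u t - I v t = exp (- K * t) * integral {0..t}
        (\<lambda>s. G s (exp (K * s) * apply_bcontfun u s) - G s (exp (K * s) * apply_bcontfun v s))"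
      unfolding I_def integral_diff[OF int_t int_t] by (simp add: algebra_simps)
    then have "\<bar>I u t - I v t\<bar> \<le> exp (- K * t) * (1 / 2 * dist u v * exp (K * t))"
      using * by (simp add: abs_mult)
    also have "\<dots> = 1 / 2 * dist u v" by (simp add: exp_minus)
    finally show "dist (apply_bcontfun (P u) \<theta>) (apply_bcontfun (P v) \<theta>) \<le> 1 / 2 * dist u v"
      by (simp add: P t_def dist_real_def)
  qed
  then obtain u where u: "P u = u"
    using banach_fix_type[of "1/2" P] by auto
  show ?thesis
  proof
    show "continuous_on {0..T} (\<lambda>t. exp (K * t) * apply_bcontfun u t)"
      by (intro continuous_intros continuous_on_apply_bcontfun)
    fix t assume t: "t \<in> {0..T}"
    have "apply_bcontfun u t = I u t" using P[of u t] c_id[OF t] u by simp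
    then show "exp (K * t) * apply_bcontfun u t =
        x0 + integral {0..t} (\<lambda>s. G s (exp (K * s) * apply_bcontfun u s))"
      by (simp add: I_def exp_minus)
  qed
qed

section \<open>The formula of Faa di Bruno\<close>

lemma finite_PiE_sum_le: "finite A \<Longrightarrow> finite {b \<in> A \<rightarrow>\<^sub>E (UNIV :: nat set). sum b A \<le> N}"
proof (rule finite_subset)
  assume A: "finite A"
  show "{b \<in> A \<rightarrow>\<^sub>E UNIV. sum b A \<le> N} \<subseteq> A \<rightarrow>\<^sub>E {..N}"
  proof
    fix b assume b: "b \<in> {b \<in> A \<rightarrow>\<^sub>E UNIV. sum b A \<le> N}"
    have "b m \<le> N" if "m \<in> A" for m
      using member_le_sum[of m A b] that A b by simp
    with b show "b \<in> A \<rightarrow>\<^sub>E {..N}" by (auto simp: PiE_iff)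
  qed
qed (auto intro: finite_PiE)

text \<open>Dividing by \<open>fact L\<close> turns powers into a convolution, so the induction only
  splits off the exponent of the new element by the binomial theorem.\<close>

lemma multinomial_fact:
  fixes x :: "'a \<Rightarrow> real"
  assumes "finite A"
  shows "(\<Sum>m\<in>A. x m) ^ L / fact L =
    (\<Sum>b | b \<in> A \<rightarrow>\<^sub>E UNIV \<and> sum b A = L. \<Prod>m\<in>A. x m ^ b m / fact (b m))"
  using assms
proof (induction A arbitrary: L)
  case empty
  have "{b. b = (\<lambda>_. undefined) \<and> sum b {} = L} = (if L = 0 then {\<lambda>_. undefined} else {})" by auto
  then show ?case by (cases L) auto
next
  case (insert a A)
  let ?S = "\<lambda>L. {b. b \<in> A \<rightarrow>\<^sub>E (UNIV :: nat set) \<and> sum b A = L}"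
  have fin: "finite (?S L)" for L
    by (rule finite_subset[OF _ finite_PiE_sum_le[OF insert.hyps(1), of L]]) auto
  have cong: "(\<Prod>m\<in>A. x m ^ (if m = a then i else b m) / fact (if m = a then i else b m)) =
      (\<Prod>m\<in>A. x m ^ b m / fact (b m))"
    "(\<Sum>m\<in>A. if m = a then i else b m) = sum b A" for b :: "'a \<Rightarrow> nat" and i
    using insert.hyps(2) by (auto intro!: prod.cong sum.cong)
  have "(\<Sum>m\<in>insert a A. x m) ^ L / fact L = (\<Sum>i\<le>L. x a ^ i / fact i * ((\<Sum>m\<in>A. x m) ^ (L - i) / fact (L - i)))"
    unfolding sum.insert [OF insert.hyps] binomial_ring sum_divide_distrib
    by (intro sum.cong refl) (simp add: binomial_fact field_simps)
  also have "\<dots> = (\<Sum>i\<le>L. \<Sum>b\<in>?S (L - i). x a ^ i / fact i * (\<Prod>m\<in>A. x m ^ b m / fact (b m)))"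
    by (simp add: insert.IH sum_distrib_left)
  also have "\<dots> = (\<Sum>(i, b)\<in>Sigma {..L} (\<lambda>i. ?S (L - i)). x a ^ i / fact i * (\<Prod>m\<in>A. x m ^ b m / fact (b m)))"
    by (rule sum.Sigma) (auto intro: fin)
  also have "\<dots> = (\<Sum>b | b \<in> insert a A \<rightarrow>\<^sub>E UNIV \<and> sum b (insert a A) = L. \<Prod>m\<in>insert a A. x m ^ b m / fact (b m))"
    by (rule sum.reindex_bij_witness[of _ "\<lambda>b. (b a, b(a := undefined))" "\<lambda>(i, b). b(a := i)"])
      (use insert.hyps in \<open>auto simp: cong PiE_iff extensional_def fun_eq_iff split: if_splits\<close>)
  finally show ?case .
qed

text \<open>The Faa di Bruno formula divided by \<open>l!\<close>: the coefficient of
  \<open>\<epsilon> ^ l\<close> in the composition of an outer function with derivatives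
  \<open>a L\<close> at the base point and an inner series with derivatives \<open>z m\<close> at
  0.\<close>

definition faa_di_bruno :: "nat \<Rightarrow> (nat \<Rightarrow> real) \<Rightarrow> (nat \<Rightarrow> real) \<Rightarrow> real" where
  "faa_di_bruno l a z = (\<Sum>b \<in> S_tuples l. 1 / (\<Prod>m = 1..l. fact (b m) * fact m ^ b m) *
     a (\<Sum>m = 1..l. b m) * (\<Prod>m = 1..l. z m ^ b m))"

lemma faa_di_bruno_0: "faa_di_bruno 0 a z = a 0"
  by (simp add: faa_di_bruno_def S_tuples_def)

text \<open>Links the separately stated first equation of the recurrence to the general
  pattern.\<close>

lemma faa_di_bruno_1: "faa_di_bruno (Suc 0) a z = a 1 * z 1"
proof -
  have "b = (\<lambda>m\<in>{Suc 0}. Suc 0)" if "b \<in> {Suc 0} \<rightarrow>\<^sub>E UNIV" "b (Suc 0) = Suc 0" for b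
    using that by (auto simp: PiE_iff extensional_def fun_eq_iff)
  moreover have "(\<lambda>m\<in>{Suc 0}. Suc 0) \<in> {Suc 0} \<rightarrow>\<^sub>E UNIV"
    by simp
  moreover have "S_tuples (Suc 0) = {b \<in> {Suc 0} \<rightarrow>\<^sub>E UNIV. b (Suc 0) = Suc 0}"
    by (simp add: S_tuples_def)
  ultimately have "S_tuples (Suc 0) = {\<lambda>m\<in>{Suc 0}. Suc 0}"
    by auto
  then show ?thesis by (simp add: faa_di_bruno_def)
qed

text \<open>Linearity in the outer derivatives lets the zone indicators pass through: the recurrence
  uses derivatives of the piecewise sum, the Taylor expansion those of one zone.\<close>

lemma faa_di_bruno_sum:
  "faa_di_bruno l (\<lambda>L. \<Sum>j\<in>J. c j * a j L) z = (\<Sum>j\<in>J. c j * faa_di_bruno l (a j) z)"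
  unfolding faa_di_bruno_def sum_distrib_left sum_distrib_right
  by (subst sum.swap) (auto intro!: sum.cong simp: ac_simps)

text \<open>Only derivatives of order at most \<open>l\<close> occur, because the sum of the
  \<open>b m\<close> is at most their weighted sum \<open>l\<close>.\<close>

lemma faa_di_bruno_continuous_on [continuous_intros]:
  assumes "\<And>L. L \<le> l \<Longrightarrow> continuous_on A (\<lambda>s. a s L)"
    and "\<And>m. m \<in> {1..l} \<Longrightarrow> continuous_on A (\<lambda>s. z s m)"
  shows "continuous_on A (\<lambda>s. faa_di_bruno l (a s) (z s))"
proof -
  have "(\<Sum>m = 1..l. b m) \<le> l" if "b \<in> S_tuples l" for b
  proof -
    have "(\<Sum>m = 1..l. b m) \<le> (\<Sum>m = 1..l. m * b m)" by (intro sum_mono) auto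
    then show ?thesis using that by (simp add: S_tuples_def)
  qed
  then show ?thesis
    unfolding faa_di_bruno_def by (intro continuous_intros assms) auto
qed

text \<open>The multinomial theorem yields tuples of length \<open>k\<close>, the recurrence tuples
  of length \<open>l\<close>. In weight \<open>l\<close> every entry with index above
  \<open>l\<close> vanishes, since \<open>m * b m\<close> is at most \<open>l\<close>; hence
  truncation and padding by zeros are inverse to each other.\<close>

lemma sum_weight_eq_faa_di_bruno:
  assumes "l \<le> k"
  shows "(\<Sum>b | b \<in> {1..k} \<rightarrow>\<^sub>E UNIV \<and> (\<Sum>m = 1..k. m * b m) = l.
      a (sum b {1..k}) * (\<Prod>m = 1..k. (z m / fact m) ^ b m / fact (b m))) = faa_di_bruno l a z"
  unfolding faa_di_bruno_def
proof (rule sum.reindex_bij_witness[of _ "\<lambda>c. \<lambda>m\<in>{1..k}. if m \<le> l then c m else 0" "\<lambda>b. restrict b {1..l}"])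
  have sub: "{1..l} \<subseteq> {1..k}" using assms by auto
  have eq: "(\<Sum>m = 1..k. m * (if m \<le> l then c m else 0)) = (\<Sum>m = 1..l. m * c m)" for c :: "nat \<Rightarrow> nat"
    by (rule sum.mono_neutral_cong_right) (use sub in auto)
  fix b assume b: "b \<in> {b. b \<in> {1..k} \<rightarrow>\<^sub>E UNIV \<and> (\<Sum>m = 1..k. m * b m) = l}"
  have b0: "b m = 0" if m: "m \<in> {1..k}" "\<not> m \<le> l" for m
  proof -
    have "m * b m \<le> l"
      using member_le_sum[of m "{1..k}" "\<lambda>m. m * b m"] b m(1) by simp
    with m(2) show ?thesis by (cases "b m") auto
  qed
  show "(\<lambda>m\<in>{1..k}. if m \<le> l then restrict b {1..l} m else 0) = b"
    using b b0 by (auto simp: fun_eq_iff PiE_iff extensional_def)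
  have "(\<Sum>m = 1..l. m * b m) = (\<Sum>m = 1..k. m * b m)"
    by (subst eq [symmetric]) (auto intro!: sum.cong simp: b0)
  with b show "restrict b {1..l} \<in> S_tuples l"
    by (simp add: S_tuples_def)
  have 1: "(\<Sum>m = 1..l. b m) = sum b {1..k}"
    by (rule sum.mono_neutral_left) (use sub b0 in auto)
  have "(\<Prod>m = 1..k. (z m / fact m) ^ b m / fact (b m)) = (\<Prod>m = 1..l. (z m / fact m) ^ b m / fact (b m))"
    by (rule prod.mono_neutral_right) (use sub b0 in auto)
  also have "\<dots> = 1 / (\<Prod>m = 1..l. fact (b m) * fact m ^ b m) * (\<Prod>m = 1..l. z m ^ b m)"
    by (simp add: prod_dividef power_divide prod.distrib field_simps)
  finally show "1 / (\<Prod>m = 1..l. fact (restrict b {1..l} m) * fact m ^ restrict b {1..l} m) *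
      a (\<Sum>m = 1..l. restrict b {1..l} m) * (\<Prod>m = 1..l. z m ^ restrict b {1..l} m) =
      a (sum b {1..k}) * (\<Prod>m = 1..k. (z m / fact m) ^ b m / fact (b m))"
    using 1 by simp
next
  have sub: "{1..l} \<subseteq> {1..k}" using assms by auto
  have eq: "(\<Sum>m = 1..k. m * (if m \<le> l then c m else 0)) = (\<Sum>m = 1..l. m * c m)" for c :: "nat \<Rightarrow> nat"
    by (rule sum.mono_neutral_cong_right) (use sub in auto)
  fix c assume c: "c \<in> S_tuples l"
  show "restrict (\<lambda>m\<in>{1..k}. if m \<le> l then c m else 0) {1..l} = c"
    using c assms by (auto simp: S_tuples_def fun_eq_iff PiE_iff extensional_def)
  show "(\<lambda>m\<in>{1..k}. if m \<le> l then c m else 0) \<in> {b. b \<in> {1..k} \<rightarrow>\<^sub>E UNIV \<and> (\<Sum>m = 1..k. m * b m) = l}"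
    using c eq[of c] by (simp add: S_tuples_def)
qed

text \<open>
  Expand the powers by the multinomial theorem and collect the monomials of weight \<open>l \<le> N\<close>; the
  finitely many others have weight at least \<open>N + 1\<close>.
\<close>

lemma faa_di_bruno_remainder:
  fixes M Z :: real
  assumes "N \<le> k" "M \<ge> 0" "Z \<ge> 0"
  shows "\<exists>C\<ge>0. \<forall>a z \<epsilon>. (\<forall>L\<le>N. \<bar>a L\<bar> \<le> M) \<longrightarrow> (\<forall>m\<in>{1..k}. \<bar>z m\<bar> \<le> Z) \<longrightarrow> \<bar>\<epsilon>\<bar> \<le> 1 \<longrightarrow>
      \<bar>(\<Sum>L\<le>N. a L / fact L * (\<Sum>m = 1..k. \<epsilon> ^ m * (z m / fact m)) ^ L) -
        (\<Sum>l\<le>N. \<epsilon> ^ l * faa_di_bruno l a z)\<bar> \<le> C * \<bar>\<epsilon>\<bar> ^ (N + 1)"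
proof -
  define B where "B = {b \<in> {1..k} \<rightarrow>\<^sub>E (UNIV :: nat set). sum b {1..k} \<le> N}"
  define w where "w b = (\<Sum>m = 1..k. m * b m)" for b :: "nat \<Rightarrow> nat"
  have fin: "finite B" unfolding B_def by (rule finite_PiE_sum_le) simp
  \<comment> \<open>Each discarded monomial is bounded by \<open>M\<close> times the product of the
    \<open>Z ^ b m\<close>, the factorials in its denominator being at least 1. The constant does
    not depend on \<open>a\<close>, \<open>z\<close> or \<epsilon>, which later makes the estimate
    uniform in the angle.\<close>
  let ?C = "\<Sum>b\<in>B. M * (\<Prod>m = 1..k. Z ^ b m)"
  have C: "?C \<ge> 0"
    using assms by (intro sum_nonneg mult_nonneg_nonneg prod_nonneg) auto
  have "\<bar>(\<Sum>L\<le>N. a L / fact L * (\<Sum>m = 1..k. \<epsilon> ^ m * (z m / fact m)) ^ L) -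
        (\<Sum>l\<le>N. \<epsilon> ^ l * faa_di_bruno l a z)\<bar> \<le> ?C * \<bar>\<epsilon>\<bar> ^ (N + 1)"
    if a: "\<forall>L\<le>N. \<bar>a L\<bar> \<le> M" and z: "\<forall>m\<in>{1..k}. \<bar>z m\<bar> \<le> Z" and \<epsilon>: "\<bar>\<epsilon>\<bar> \<le> 1" for a z \<epsilon>
  proof -
    define q where "q b = a (sum b {1..k}) * (\<Prod>m = 1..k. (z m / fact m) ^ b m / fact (b m))" for b
    have q: "a (sum b {1..k}) * (\<Prod>m = 1..k. (\<epsilon> ^ m * (z m / fact m)) ^ b m / fact (b m)) = \<epsilon> ^ w b * q b" for b
    proof -
      have "(\<Prod>m = 1..k. (\<epsilon> ^ m * (z m / fact m)) ^ b m / fact (b m)) =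
          (\<Prod>m = 1..k. \<epsilon> ^ (m * b m) * ((z m / fact m) ^ b m / fact (b m)))"
        by (intro prod.cong refl) (subst power_mult_distrib, subst power_mult, rule times_divide_eq_right [symmetric])
      also have "\<dots> = \<epsilon> ^ w b * (\<Prod>m = 1..k. (z m / fact m) ^ b m / fact (b m))"
        by (simp only: prod.distrib w_def power_sum)
      finally show ?thesis by (simp only: q_def mult.left_commute)
    qed
    have "(\<Sum>L\<le>N. a L / fact L * (\<Sum>m = 1..k. \<epsilon> ^ m * (z m / fact m)) ^ L) =
      (\<Sum>L\<le>N. a L * (\<Sum>b | b \<in> {1..k} \<rightarrow>\<^sub>E UNIV \<and> sum b {1..k} = L.
         \<Prod>m = 1..k. (\<epsilon> ^ m * (z m / fact m)) ^ b m / fact (b m)))"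
      by (subst multinomial_fact [symmetric]) auto
    also have "\<dots> = (\<Sum>L\<le>N. \<Sum>b | b \<in> {1..k} \<rightarrow>\<^sub>E UNIV \<and> sum b {1..k} = L. \<epsilon> ^ w b * q b)"
      unfolding sum_distrib_left by (intro sum.cong refl) (auto simp flip: q)
    also have "\<dots> = (\<Sum>L\<le>N. \<Sum>b | b \<in> B \<and> sum b {1..k} = L. \<epsilon> ^ w b * q b)"
      by (intro sum.cong refl) (auto simp: B_def)
    also have "\<dots> = (\<Sum>b\<in>B. \<epsilon> ^ w b * q b)"
      by (rule sum.group) (auto simp: fin, auto simp: B_def)
    also have "\<dots> = (\<Sum>b | b \<in> B \<and> w b \<le> N. \<epsilon> ^ w b * q b) + (\<Sum>b | b \<in> B \<and> \<not> w b \<le> N. \<epsilon> ^ w b * q b)"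
      by (subst sum.union_disjoint [symmetric]) (auto simp: fin intro!: sum.cong)
    also have "(\<Sum>b | b \<in> B \<and> w b \<le> N. \<epsilon> ^ w b * q b) =
        (\<Sum>l\<le>N. \<Sum>b | b \<in> {b. b \<in> B \<and> w b \<le> N} \<and> w b = l. \<epsilon> ^ w b * q b)"
      by (rule sum.group [symmetric]) (auto simp: fin)
    also have "\<dots> = (\<Sum>l\<le>N. \<epsilon> ^ l * (\<Sum>b | b \<in> {1..k} \<rightarrow>\<^sub>E UNIV \<and> w b = l. q b))"
    proof (intro sum.cong refl)
      fix l assume l: "l \<in> {..N}"
      \<comment> \<open>The degree never exceeds the weight, so the degree bound built into
        \<open>B\<close> removes no monomial of weight at most \<open>N\<close>.\<close>
      have "sum b {1..k} \<le> w b" for b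
        unfolding w_def by (intro sum_mono) auto
      then have "{b. b \<in> {b. b \<in> B \<and> w b \<le> N} \<and> w b = l} = {b. b \<in> {1..k} \<rightarrow>\<^sub>E UNIV \<and> w b = l}"
        using l by (auto simp: B_def intro: order_trans)
      then show "(\<Sum>b | b \<in> {b. b \<in> B \<and> w b \<le> N} \<and> w b = l. \<epsilon> ^ w b * q b) =
          \<epsilon> ^ l * (\<Sum>b | b \<in> {1..k} \<rightarrow>\<^sub>E UNIV \<and> w b = l. q b)"
        by (auto simp: sum_distrib_left intro!: sum.cong)
    qed
    also have "\<dots> = (\<Sum>l\<le>N. \<epsilon> ^ l * faa_di_bruno l a z)"
      using \<open>N \<le> k\<close> unfolding q_def w_def
      by (intro sum.cong refl arg_cong2[of _ _ _ _ "(*)"] sum_weight_eq_faa_di_bruno) auto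
    finally have "\<bar>(\<Sum>L\<le>N. a L / fact L * (\<Sum>m = 1..k. \<epsilon> ^ m * (z m / fact m)) ^ L) -
          (\<Sum>l\<le>N. \<epsilon> ^ l * faa_di_bruno l a z)\<bar> = \<bar>\<Sum>b | b \<in> B \<and> \<not> w b \<le> N. \<epsilon> ^ w b * q b\<bar>"
      by simp
    also have "\<dots> \<le> (\<Sum>b | b \<in> B \<and> \<not> w b \<le> N. \<bar>\<epsilon> ^ w b * q b\<bar>)"
      by (rule sum_abs)
    also have "\<dots> \<le> (\<Sum>b | b \<in> B \<and> \<not> w b \<le> N. \<bar>\<epsilon>\<bar> ^ (N + 1) * (M * (\<Prod>m = 1..k. Z ^ b m)))"
    proof (intro sum_mono)
      fix b assume b: "b \<in> {b. b \<in> B \<and> \<not> w b \<le> N}"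
      have "\<bar>q b\<bar> \<le> M * (\<Prod>m = 1..k. Z ^ b m)"
        unfolding q_def abs_mult abs_prod
      proof (intro mult_mono prod_mono conjI)
        show "\<bar>a (sum b {1..k})\<bar> \<le> M" using b a by (auto simp: B_def)
        fix m assume m: "m \<in> {1..k}"
        have "\<bar>z m / fact m\<bar> \<le> Z / 1"
          unfolding abs_divide using z m by (intro frac_le) (auto simp: fact_ge_1)
        then have "\<bar>z m / fact m\<bar> ^ b m \<le> Z ^ b m" by (intro power_mono) auto
        then have "\<bar>z m / fact m\<bar> ^ b m / fact (b m) \<le> Z ^ b m / 1"
          using \<open>Z \<ge> 0\<close> by (intro frac_le) (auto simp: fact_ge_1)
        then show "\<bar>(z m / fact m) ^ b m / fact (b m)\<bar> \<le> Z ^ b m" by (simp add: power_abs)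
      qed (use assms in \<open>auto intro!: prod_nonneg\<close>)
      moreover have "\<bar>\<epsilon>\<bar> ^ w b \<le> \<bar>\<epsilon>\<bar> ^ (N + 1)"
        using b \<epsilon> by (intro power_decreasing) auto
      ultimately show "\<bar>\<epsilon> ^ w b * q b\<bar> \<le> \<bar>\<epsilon>\<bar> ^ (N + 1) * (M * (\<Prod>m = 1..k. Z ^ b m))"
        unfolding abs_mult power_abs by (intro mult_mono) auto
    qed
    also have "\<dots> \<le> (\<Sum>b\<in>B. \<bar>\<epsilon>\<bar> ^ (N + 1) * (M * (\<Prod>m = 1..k. Z ^ b m)))"
      by (intro sum_mono2 mult_nonneg_nonneg prod_nonneg) (use assms fin in auto)
    also have "\<dots> = ?C * \<bar>\<epsilon>\<bar> ^ (N + 1)"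
      unfolding sum_distrib_right by (intro sum.cong refl) (rule mult.commute)
    finally show ?thesis .
  qed
  with C show ?thesis by blast
qed

section \<open>Partial derivatives and Taylor bounds\<close>

lemma Ck_continuous_on: "Ck m f S \<Longrightarrow> continuous_on S f"
  by (cases m) (auto intro!: continuous_at_imp_continuous_on differentiable_imp_continuous_within)

text \<open>On an open set the derivative depends only on values inside the set, so the equality
  passes to the directional derivatives and the induction goes through.\<close>

lemma Ck_cong_open:
  assumes "open S" "Ck m f S" "\<And>x. x \<in> S \<Longrightarrow> f x = g x"
  shows "Ck m g S"
  using assms(2,3)
proof (induction m arbitrary: f g)
  case 0
  then show ?case by (simp cong: continuous_on_cong)
next
  case (Suc m)
  have der: "(g has_derivative frechet_derivative f (at x)) (at x)" if "x \<in> S" for x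
    using Suc.prems that \<open>open S\<close>
    by (auto intro: has_derivative_transform_within_open simp: frechet_derivative_works)
  then have eq: "frechet_derivative f (at x) = frechet_derivative g (at x)" if "x \<in> S" for x
    using that by (metis frechet_derivative_at)
  have "Ck m (\<lambda>x. frechet_derivative f (at x) v) S" for v
    using Suc.prems(1) by simp
  then have "Ck m (\<lambda>x. frechet_derivative g (at x) v) S" for v
    by (rule Suc.IH) (simp only: eq)
  with der show ?case by (auto simp: differentiable_def)
qed

text \<open>The radial derivative is the component of the total derivative in direction
  \<open>(0, 1)\<close>, hence it loses exactly one order of smoothness and can be iterated.\<close>

lemma Ck_partial_derivative:
  fixes g :: "real \<Rightarrow> real \<Rightarrow> real"
  assumes "open D" "Ck (Suc m) (\<lambda>(\<theta>, r). g \<theta> r) (UNIV \<times> D)"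
  shows "r \<in> D \<Longrightarrow> (g \<theta> has_real_derivative deriv (g \<theta>) r) (at r)"
    and "Ck m (\<lambda>(\<theta>, r). deriv (g \<theta>) r) (UNIV \<times> D)"
proof -
  define f where "f = (\<lambda>(\<theta>, r). g \<theta> r)"
  define f' where "f' x = frechet_derivative f (at x)" for x
  have d: "(g \<theta> has_real_derivative f' (\<theta>, r) (0, 1)) (at r)" if "r \<in> D" for \<theta> r
  proof -
    have f': "(f has_derivative f' (\<theta>, r)) (at (\<theta>, r))"
      using assms(2) that unfolding f'_def frechet_derivative_works [symmetric] by (simp add: f_def)
    have "((\<lambda>r. f (\<theta>, r)) has_derivative (\<lambda>h. f' (\<theta>, r) (0, h))) (at r)"
      by (rule has_derivative_compose[of "\<lambda>r. (\<theta>, r)" "\<lambda>h. (0, h)", OF _ f'])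
        (auto intro!: derivative_eq_intros)
    moreover have "(\<lambda>h. f' (\<theta>, r) (0, h)) = (*) (f' (\<theta>, r) (0, 1))"
    proof
      show "f' (\<theta>, r) (0, h) = f' (\<theta>, r) (0, 1) * h" for h
        using linear_cmul[OF has_derivative_linear[OF f'], of h "(0, 1)"] by simp
    qed
    ultimately show ?thesis
      by (simp add: has_field_derivative_def f_def)
  qed
  then show "(g \<theta> has_real_derivative deriv (g \<theta>) r) (at r)" if "r \<in> D"
    using that by (metis DERIV_imp_deriv)
  show "Ck m (\<lambda>(\<theta>, r). deriv (g \<theta>) r) (UNIV \<times> D)"
  proof (rule Ck_cong_open)
    show "open (UNIV \<times> D)" using \<open>open D\<close> by (simp add: open_Times)
    show "Ck m (\<lambda>x. f' x (0, 1)) (UNIV \<times> D)"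
      using assms(2) by (simp add: f'_def f_def)
  qed (auto simp: DERIV_imp_deriv[OF d])
qed

lemma Ck_iterated_partial_derivative:
  fixes g :: "real \<Rightarrow> real \<Rightarrow> real"
  assumes "open D" "Ck m (\<lambda>(\<theta>, r). g \<theta> r) (UNIV \<times> D)" "L \<le> m"
  shows "Ck (m - L) (\<lambda>(\<theta>, r). (deriv ^^ L) (g \<theta>) r) (UNIV \<times> D)"
  using \<open>L \<le> m\<close>
proof (induction L)
  case (Suc L)
  then show ?case
    using Ck_partial_derivative(2)[OF \<open>open D\<close>, of "m - Suc L" "\<lambda>\<theta>. (deriv ^^ L) (g \<theta>)"]
    by (simp add: Suc_diff_Suc)
qed (use assms in simp)

lemma Ck_iterated_deriv:
  fixes g :: "real \<Rightarrow> real \<Rightarrow> real"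
  assumes "open D" "Ck m (\<lambda>(\<theta>, r). g \<theta> r) (UNIV \<times> D)"
  shows "L < m \<Longrightarrow> r \<in> D \<Longrightarrow>
      ((deriv ^^ L) (g \<theta>) has_real_derivative (deriv ^^ Suc L) (g \<theta>) r) (at r)"
    and "L \<le> m \<Longrightarrow> continuous_on (UNIV \<times> D) (\<lambda>(\<theta>, r). (deriv ^^ L) (g \<theta>) r)"
proof -
  show "((deriv ^^ L) (g \<theta>) has_real_derivative (deriv ^^ Suc L) (g \<theta>) r) (at r)" if "L < m" "r \<in> D"
    using Ck_partial_derivative(1)[OF \<open>open D\<close>, of "m - Suc L" "\<lambda>\<theta>. (deriv ^^ L) (g \<theta>)" r]
      Ck_iterated_partial_derivative[OF assms, of L] that
    by (simp add: Suc_diff_Suc)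
  show "continuous_on (UNIV \<times> D) (\<lambda>(\<theta>, r). (deriv ^^ L) (g \<theta>) r)" if "L \<le> m"
    using Ck_continuous_on[OF Ck_iterated_partial_derivative[OF assms that]] .
qed

text \<open>Provides the Lipschitz constant of \<open>R\<close> in the radius, uniform in the angle
  and in \<epsilon>; for that, one continuous partial derivative suffices.\<close>

lemma Ck_middle_partial_derivative:
  fixes g :: "real \<Rightarrow> real \<Rightarrow> real \<Rightarrow> real"
  assumes "Ck (Suc m) (\<lambda>(\<theta>, r, \<epsilon>). g \<theta> r \<epsilon>) (UNIV \<times> D \<times> E)"
  obtains g' where "continuous_on (UNIV \<times> D \<times> E) (\<lambda>(\<theta>, r, \<epsilon>). g' \<theta> r \<epsilon>)"
    and "\<And>\<theta> r \<epsilon>. r \<in> D \<Longrightarrow> \<epsilon> \<in> E \<Longrightarrow> ((\<lambda>r. g \<theta> r \<epsilon>) has_real_derivative g' \<theta> r \<epsilon>) (at r)"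
proof
  define f where "f = (\<lambda>(\<theta>, r, \<epsilon>). g \<theta> r \<epsilon>)"
  define f' where "f' x = frechet_derivative f (at x)" for x
  have "continuous_on (UNIV \<times> D \<times> E) (\<lambda>x. f' x (0, 1, 0))"
    using assms by (intro Ck_continuous_on[of m]) (simp add: f'_def f_def)
  then show "continuous_on (UNIV \<times> D \<times> E) (\<lambda>(\<theta>, r, \<epsilon>). f' (\<theta>, r, \<epsilon>) (0, 1, 0))"
    by (simp add: case_prod_unfold)
  show "((\<lambda>r. g \<theta> r \<epsilon>) has_real_derivative f' (\<theta>, r, \<epsilon>) (0, 1, 0)) (at r)" if "r \<in> D" "\<epsilon> \<in> E" for \<theta> r \<epsilon>
  proof -
    have f': "(f has_derivative f' (\<theta>, r, \<epsilon>)) (at (\<theta>, r, \<epsilon>))"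
      using assms that unfolding f'_def frechet_derivative_works [symmetric] by (simp add: f_def)
    have "((\<lambda>r. f (\<theta>, r, \<epsilon>)) has_derivative (\<lambda>h. f' (\<theta>, r, \<epsilon>) (0, h, 0))) (at r)"
      by (rule has_derivative_compose[of "\<lambda>r. (\<theta>, r, \<epsilon>)" "\<lambda>h. (0, h, 0)", OF _ f'])
        (auto intro!: derivative_eq_intros)
    moreover have "(\<lambda>h. f' (\<theta>, r, \<epsilon>) (0, h, 0)) = (*) (f' (\<theta>, r, \<epsilon>) (0, 1, 0))"
    proof
      show "f' (\<theta>, r, \<epsilon>) (0, h, 0) = f' (\<theta>, r, \<epsilon>) (0, 1, 0) * h" for h
        using linear_cmul[OF has_derivative_linear[OF f'], of h "(0, 1, 0)"] by simp
    qed
    ultimately show ?thesis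
      by (simp add: has_field_derivative_def f_def)
  qed
qed

lemma bounded_family_on_compact:
  fixes f :: "'i \<Rightarrow> 'a::metric_space \<Rightarrow> real"
  assumes "finite I" "compact K" "\<And>i. i \<in> I \<Longrightarrow> continuous_on K (f i)"
  obtains B where "B \<ge> 0" "\<And>i x. i \<in> I \<Longrightarrow> x \<in> K \<Longrightarrow> \<bar>f i x\<bar> \<le> B"
proof -
  have "bounded (\<Union>i\<in>I. f i ` K)"
    using assms by (auto intro!: bounded_UN compact_imp_bounded compact_continuous_image)
  then obtain B where "B > 0" "\<forall>y\<in>(\<Union>i\<in>I. f i ` K). norm y \<le> B"
    by (auto simp: bounded_pos)
  then show ?thesis by (intro that[of B]) auto
qed

text \<open>The Lagrange remainder with its factorial estimated away. At \<open>x = c\<close> there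
  is no intermediate point, and only the term of order 0 survives, by
  \<open>0 ^ 0 = 1\<close>.\<close>

lemma taylor_iterated_deriv_bound:
  fixes f :: "real \<Rightarrow> real"
  assumes deriv: "\<And>L r. L \<le> N \<Longrightarrow> r \<in> {a..b} \<Longrightarrow> ((deriv ^^ L) f has_real_derivative (deriv ^^ Suc L) f r) (at r)"
    and bound: "\<And>r. r \<in> {a..b} \<Longrightarrow> \<bar>(deriv ^^ Suc N) f r\<bar> \<le> B"
    and x: "x \<in> {a..b}" and c: "c \<in> {a..b}"
  shows "\<bar>f x - (\<Sum>L\<le>N. (deriv ^^ L) f c / fact L * (x - c) ^ L)\<bar> \<le> B * \<bar>x - c\<bar> ^ (N + 1)"
proof (cases "x = c")
  case True
  have "(\<Sum>L\<le>N. (deriv ^^ L) f c / fact L * 0 ^ L) = f c"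
    by (subst sum.atMost_shift) simp
  with True show ?thesis by simp
next
  case False
  have "B \<ge> 0" using bound[OF x] by linarith
  obtain t where t: "if x < c then x < t \<and> t < c else c < t \<and> t < x"
    and eq: "f x = (\<Sum>L<Suc N. (deriv ^^ L) f c / fact L * (x - c) ^ L) +
      (deriv ^^ Suc N) f t / fact (Suc N) * (x - c) ^ Suc N"
    using Taylor[of "Suc N" "\<lambda>L. (deriv ^^ L) f" f a b c x] deriv False x c by force
  have "t \<in> {a..b}" using t x c by (auto split: if_splits)
  then have le: "\<bar>(deriv ^^ Suc N) f t / fact (Suc N)\<bar> \<le> B / 1"
    unfolding abs_divide using \<open>B \<ge> 0\<close> bound by (intro frac_le) (auto simp del: fact_Suc funpow.simps simp: fact_ge_1)
  have "\<bar>f x - (\<Sum>L\<le>N. (deriv ^^ L) f c / fact L * (x - c) ^ L)\<bar> =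
      \<bar>(deriv ^^ Suc N) f t / fact (Suc N)\<bar> * \<bar>x - c\<bar> ^ (N + 1)"
    unfolding eq lessThan_Suc_atMost by (simp only: add_diff_cancel_left' abs_mult power_abs Suc_eq_plus1)
  also have "\<dots> \<le> B / 1 * \<bar>x - c\<bar> ^ (N + 1)"
    by (rule mult_right_mono[OF le]) simp
  finally show ?thesis by simp
qed

section \<open>Piecewise equations\<close>

locale zones =
  fixes n :: nat and \<alpha> :: "nat \<Rightarrow> real"
  assumes first: "\<alpha> 0 = 0" and last: "\<alpha> n = 2 * pi"
    and increasing: "\<And>j. j < n \<Longrightarrow> \<alpha> j < \<alpha> (Suc j)"
begin

lemma mono: "i \<le> j \<Longrightarrow> j \<le> n \<Longrightarrow> \<alpha> i \<le> \<alpha> j"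
proof (induction j rule: dec_induct)
  case (step j)
  then show ?case using increasing[of j] by simp
qed simp

lemma zone_subset: "j \<in> {1..n} \<Longrightarrow> {\<alpha> (j - 1)..\<alpha> j} \<subseteq> {0..2 * pi}"
  using mono[of 0 "j - 1"] mono[of j n] by (auto simp: first last)

lemma interior_zone:
  assumes "\<theta> \<in> {0..2 * pi} - \<alpha> ` {0..n}"
  obtains j where "j \<in> {1..n}" "\<alpha> (j - 1) < \<theta>" "\<theta> < \<alpha> j"
proof -
  have *: "\<theta> \<noteq> \<alpha> i" if "i \<le> n" for i using assms that by auto
  have "\<theta> < \<alpha> n" using assms *[of n] last by simp
  \<comment> \<open>The first breakpoint beyond \<theta> closes the zone that contains
    \<theta>.\<close>
  define j where "j = (LEAST j. \<theta> < \<alpha> j)"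
  have j: "\<theta> < \<alpha> j" "j \<le> n"
    unfolding j_def using \<open>\<theta> < \<alpha> n\<close> by (auto intro: LeastI Least_le)
  have "j \<noteq> 0" using j(1) first assms by (cases j) auto
  moreover have "\<not> \<theta> < \<alpha> (j - 1)"
    using \<open>j \<noteq> 0\<close> not_less_Least[of "j - 1" "\<lambda>j. \<theta> < \<alpha> j"] by (simp add: j_def)
  moreover have "\<theta> \<noteq> \<alpha> (j - 1)" using j(2) by (intro *) simp
  ultimately show ?thesis using j by (intro that[of j]) auto
qed

text \<open>Strict inequalities are essential: the zones are closed, so at a breakpoint shared by
  two zones \<open>piecewise\<close> adds both values. Integrals ignore this finite set.\<close>

lemma piecewise_interior:
  assumes "j \<in> {1..n}" "\<alpha> (j - 1) < \<theta>" "\<theta> < \<alpha> j"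
  shows "piecewise n \<alpha> G \<theta> r = G j \<theta> r"
proof -
  have "indicator {\<alpha> (i - 1)..\<alpha> i} \<theta> * G i \<theta> r = (if i = j then G j \<theta> r else 0)" if "i \<in> {1..n}" for i
  proof (cases i j rule: linorder_cases)
    case less
    then have "\<alpha> i \<le> \<alpha> (j - 1)" using assms(1) by (intro mono) auto
    then show ?thesis using assms less by auto
  next
    case greater
    then have "\<alpha> j \<le> \<alpha> (i - 1)" using that by (intro mono) auto
    then show ?thesis using assms greater by auto
  qed (use assms in auto)
  then have "piecewise n \<alpha> G \<theta> r = (\<Sum>i = 1..n. if i = j then G j \<theta> r else 0)"
    unfolding piecewise_def by (intro sum.cong refl)
  with assms(1) show ?thesis by simp
qed

lemma piecewise_integrable:
  assumes "\<And>j. j \<in> {1..n} \<Longrightarrow> continuous_on {\<alpha> (j - 1)..\<alpha> j} (\<lambda>s. G j s (x s))"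
  shows "(\<lambda>s. piecewise n \<alpha> G s (x s)) integrable_on {0..2 * pi}"
  unfolding piecewise_def
proof (rule integrable_sum)
  fix j assume j: "j \<in> {1..n}"
  have "(\<lambda>s. G j s (x s)) integrable_on {\<alpha> (j - 1)..\<alpha> j} \<inter> {0..2 * pi}"
    unfolding Int_absorb2[OF zone_subset[OF j]] by (rule integrable_continuous_interval[OF assms[OF j]])
  then have "(\<lambda>s. if s \<in> {\<alpha> (j - 1)..\<alpha> j} then G j s (x s) else 0) integrable_on {0..2 * pi}"
    by (simp only: integrable_restrict_Int)
  then show "(\<lambda>s. indicator {\<alpha> (j - 1)..\<alpha> j} s * G j s (x s)) integrable_on {0..2 * pi}"
    by (rule integrable_eq) (simp add: indicator_def)
qed simp

text \<open>The factor \<open>n\<close> is generous, since at most two zones share an angle, but it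
  makes the bound valid at the breakpoints too, without a case distinction.\<close>

lemma piecewise_diff_le:
  assumes "\<And>j. j \<in> {1..n} \<Longrightarrow> \<theta> \<in> {\<alpha> (j - 1)..\<alpha> j} \<Longrightarrow> \<bar>G j \<theta> r - H j \<theta> q\<bar> \<le> B" and "B \<ge> 0"
  shows "\<bar>piecewise n \<alpha> G \<theta> r - piecewise n \<alpha> H \<theta> q\<bar> \<le> real n * B"
proof -
  have "\<bar>piecewise n \<alpha> G \<theta> r - piecewise n \<alpha> H \<theta> q\<bar> =
      \<bar>\<Sum>j = 1..n. indicator {\<alpha> (j - 1)..\<alpha> j} \<theta> * (G j \<theta> r - H j \<theta> q)\<bar>"
    by (simp add: piecewise_def sum_subtractf right_diff_distrib)
  also have "\<dots> \<le> (\<Sum>j = 1..n. B)"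
    by (rule order.trans[OF sum_abs sum_mono]) (use assms in \<open>auto simp: indicator_def\<close>)
  finally show ?thesis by simp
qed

text \<open>The fundamental theorem tolerates a finite exceptional set. Away from the breakpoints
  the derivative within a zone is an ordinary one and \<open>piecewise\<close> is the field of that
  zone.\<close>

lemma pw_solution_imp_integral_equation:
  assumes "pw_solution n \<alpha> D G x" "t \<in> {0..2 * pi}"
  shows "x t = x 0 + integral {0..t} (\<lambda>s. piecewise n \<alpha> G s (x s))"
proof -
  have "((\<lambda>s. piecewise n \<alpha> G s (x s)) has_integral x t - x 0) {0..t}"
  proof (rule fundamental_theorem_of_calculus_interior_strong)
    show "finite (\<alpha> ` {0..n})" by simp
    show "0 \<le> t" using assms by simp
    show "continuous_on {0..t} x"
      by (rule continuous_on_subset[of "{0..2 * pi}"]) (use assms in \<open>auto simp: pw_solution_def\<close>)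
    fix s assume s: "s \<in> {0<..<t} - \<alpha> ` {0..n}"
    then obtain j where j: "j \<in> {1..n}" "\<alpha> (j - 1) < s" "s < \<alpha> j"
      using assms(2) by (auto intro: interior_zone[of s])
    then have "(x has_real_derivative G j s (x s)) (at s within {\<alpha> (j - 1)..\<alpha> j})"
      using assms(1) by (auto simp: pw_solution_def)
    then show "(x has_vector_derivative piecewise n \<alpha> G s (x s)) (at s)"
      unfolding at_within_Icc_at[OF j(2,3)] piecewise_interior[OF j]
      by (simp add: has_real_derivative_iff_has_vector_derivative)
  qed
  then show ?thesis by (simp add: integral_unique)
qed

text \<open>Within a zone the integrand may be replaced by the continuous field of that zone, as
  they agree off the two ends. Differentiating this integral then gives the one-sided derivatives at
  the ends as well.\<close>

lemma integral_equation_imp_pw_solution: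
  assumes cont: "\<And>j. j \<in> {1..n} \<Longrightarrow> continuous_on {\<alpha> (j - 1)..\<alpha> j} (\<lambda>s. G j s (x s))"
    and x: "continuous_on {0..2 * pi} x" "\<And>t. t \<in> {0..2 * pi} \<Longrightarrow> x t \<in> D"
    and eq: "\<And>t. t \<in> {0..2 * pi} \<Longrightarrow> x t = x0 + integral {0..t} (\<lambda>s. piecewise n \<alpha> G s (x s))"
  shows "pw_solution n \<alpha> D G x"
  unfolding pw_solution_def
proof (intro conjI ballI x)
  fix j \<theta> assume j: "j \<in> {1..n}" and \<theta>: "\<theta> \<in> {\<alpha> (j - 1)..\<alpha> j}"
  let ?g = "\<lambda>s. piecewise n \<alpha> G s (x s)"
  have sub: "{\<alpha> (j - 1)..\<alpha> j} \<subseteq> {0..2 * pi}" by (rule zone_subset[OF j])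
  have x_eq: "x t = x (\<alpha> (j - 1)) + integral {\<alpha> (j - 1)..t} (\<lambda>s. G j s (x s))" if t: "t \<in> {\<alpha> (j - 1)..\<alpha> j}" for t
  proof -
    have "0 \<le> \<alpha> (j - 1)" "\<alpha> (j - 1) \<le> t" "t \<le> 2 * pi" using sub t by auto
    moreover from this have "?g integrable_on {0..t}"
      by (intro integrable_on_subinterval[OF piecewise_integrable[of G x, OF cont]]) auto
    ultimately have "integral {0..\<alpha> (j - 1)} ?g + integral {\<alpha> (j - 1)..t} ?g = integral {0..t} ?g"
      by (intro Henstock_Kurzweil_Integration.integral_combine)
    moreover have "integral {\<alpha> (j - 1)..t} ?g = integral {\<alpha> (j - 1)..t} (\<lambda>s. G j s (x s))"
      by (rule integral_spike[of "{\<alpha> (j - 1), \<alpha> j}"])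
        (use t in \<open>auto intro!: piecewise_interior[OF j, symmetric]\<close>)
    moreover have "t \<in> {0..2 * pi}" "\<alpha> (j - 1) \<in> {0..2 * pi}" using sub t by auto
    ultimately show ?thesis using eq by fastforce
  qed
  have "((\<lambda>t. x (\<alpha> (j - 1)) + integral {\<alpha> (j - 1)..t} (\<lambda>s. G j s (x s))) has_real_derivative G j \<theta> (x \<theta>))
      (at \<theta> within {\<alpha> (j - 1)..\<alpha> j})"
    using DERIV_add[OF DERIV_const integral_has_real_derivative[OF cont[OF j] \<theta>], of "x (\<alpha> (j - 1))"] by simp
  then show "(x has_real_derivative G j \<theta> (x \<theta>)) (at \<theta> within {\<alpha> (j - 1)..\<alpha> j})"
    by (rule has_field_derivative_transform_within[where d = 1]) (simp, rule \<theta>, erule x_eq [symmetric])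
qed

end

section \<open>Perturbation expansion\<close>

text \<open>As \<open>D\<close> is an interval, the hull of \<open>K\<close> can be widened inside
  it by checking the two ends only; the smaller of their margins serves every point of
  \<open>K\<close>.\<close>

lemma compact_interval_neighbourhood:
  fixes D K :: "real set"
  assumes "open D" "is_interval D" "compact K" "K \<noteq> {}" "K \<subseteq> D"
  obtains a b \<eta> where "\<eta> > 0" "{a..b} \<subseteq> D" "\<And>x. x \<in> K \<Longrightarrow> {x - \<eta>..x + \<eta>} \<subseteq> {a..b}"
proof -
  obtain u v where uv: "u \<in> K" "v \<in> K" and le: "\<And>x. x \<in> K \<Longrightarrow> u \<le> x \<and> x \<le> v"
    using compact_attains_inf[OF assms(3,4)] compact_attains_sup[OF assms(3,4)] by metis
  obtain \<eta>1 where "\<eta>1 > 0" "cball u \<eta>1 \<subseteq> D"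
    using assms uv open_contains_cball[of D] by blast
  moreover obtain \<eta>2 where "\<eta>2 > 0" "cball v \<eta>2 \<subseteq> D"
    using assms uv open_contains_cball[of D] by blast
  ultimately have D: "u - min \<eta>1 \<eta>2 \<in> D" "v + min \<eta>1 \<eta>2 \<in> D" and "min \<eta>1 \<eta>2 > 0"
    by (auto simp: subset_iff dist_real_def)
  show ?thesis
  proof (rule that[OF \<open>min \<eta>1 \<eta>2 > 0\<close>])
    show "{u - min \<eta>1 \<eta>2..v + min \<eta>1 \<eta>2} \<subseteq> D"
      using mem_is_interval_1_I[OF \<open>is_interval D\<close> D] by auto
    show "{x - min \<eta>1 \<eta>2..x + min \<eta>1 \<eta>2} \<subseteq> {u - min \<eta>1 \<eta>2..v + min \<eta>1 \<eta>2}" if "x \<in> K" for x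
      using le[OF that] by auto
  qed
qed

lemma sum_powers_le:
  fixes \<epsilon> Z :: real
  assumes "\<bar>\<epsilon>\<bar> \<le> 1" "\<And>m. m \<in> {1..k} \<Longrightarrow> \<bar>z m\<bar> \<le> Z"
  shows "\<bar>\<Sum>m = 1..k. \<epsilon> ^ m * (z m / fact m)\<bar> \<le> real k * Z * \<bar>\<epsilon>\<bar>"
proof -
  have "\<bar>\<epsilon> ^ m * (z m / fact m)\<bar> \<le> \<bar>\<epsilon>\<bar> * Z" if m: "m \<in> {1..k}" for m
  proof -
    have "\<bar>\<epsilon>\<bar> ^ m \<le> \<bar>\<epsilon>\<bar> ^ 1" using assms(1) m by (intro power_decreasing) auto
    moreover have "\<bar>z m\<bar> / fact m \<le> Z / 1"
      using assms(2)[OF m] by (intro frac_le) (auto simp: fact_ge_1)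
    ultimately have "\<bar>\<epsilon>\<bar> ^ m * (\<bar>z m\<bar> / fact m) \<le> \<bar>\<epsilon>\<bar> * Z"
      by (intro mult_mono) auto
    then show ?thesis by (simp add: abs_mult power_abs)
  qed
  then have "\<bar>\<Sum>m = 1..k. \<epsilon> ^ m * (z m / fact m)\<bar> \<le> (\<Sum>m = 1..k. \<bar>\<epsilon>\<bar> * Z)"
    by (intro order.trans[OF sum_abs sum_mono]) auto
  then show ?thesis by (simp add: ac_simps)
qed

locale piecewise_perturbation = zones n \<alpha> for n :: nat and \<alpha> :: "nat \<Rightarrow> real" +
  fixes k :: nat and D :: "real set" and \<epsilon>\<^sub>0 :: real
    and F :: "nat \<Rightarrow> nat \<Rightarrow> real \<Rightarrow> real \<Rightarrow> real"
    and R :: "nat \<Rightarrow> real \<Rightarrow> real \<Rightarrow> real \<Rightarrow> real"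
  assumes open_D: "open D" and interval_D: "is_interval D" and \<epsilon>\<^sub>0: "\<epsilon>\<^sub>0 > 0"
    and F_Ck: "\<And>i j. i \<le> k \<Longrightarrow> j \<in> {1..n} \<Longrightarrow> Ck (k + 1) (\<lambda>(\<theta>, r). F i j \<theta> r) (UNIV \<times> D)"
    and R_Ck: "\<And>j. j \<in> {1..n} \<Longrightarrow>
          Ck (k + 1) (\<lambda>(\<theta>, r, \<epsilon>). R j \<theta> r \<epsilon>) (UNIV \<times> D \<times> {-\<epsilon>\<^sub>0<..<\<epsilon>\<^sub>0})"
begin

text \<open>The bound 1 lets higher powers of \<epsilon> be estimated by lower ones; the half of
  \<open>\<epsilon>\<^sub>0\<close> makes the closed range of \<epsilon> a compact subset of the
  open domain of \<open>R\<close>.\<close>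

definition \<epsilon>\<^sub>1 :: real where "\<epsilon>\<^sub>1 = min 1 (\<epsilon>\<^sub>0 / 2)"

lemma \<epsilon>\<^sub>1: "\<epsilon>\<^sub>1 > 0" "\<epsilon>\<^sub>1 \<le> 1" "\<epsilon>\<^sub>1 < \<epsilon>\<^sub>0"
  using \<epsilon>\<^sub>0 by (auto simp: \<epsilon>\<^sub>1_def min_def)

section \<open>Regularity and uniform bounds of the fields\<close>

lemma F_deriv:
  assumes "i \<le> k" "j \<in> {1..n}" "L \<le> k" "r \<in> D"
  shows "((deriv ^^ L) (F i j \<theta>) has_real_derivative (deriv ^^ Suc L) (F i j \<theta>) r) (at r)"
  using Ck_iterated_deriv(1)[OF open_D F_Ck[OF assms(1,2)], of L r] assms by simp

lemma F_deriv_continuous_on: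
  assumes "i \<le> k" "j \<in> {1..n}" "L \<le> k + 1" "continuous_on A x" "x ` A \<subseteq> D"
  shows "continuous_on A (\<lambda>s. (deriv ^^ L) (F i j s) (x s))"
proof -
  have "continuous_on A (\<lambda>s. (s, x s))" "(\<lambda>s. (s, x s)) ` A \<subseteq> UNIV \<times> D"
    using assms by (auto intro!: continuous_intros)
  from continuous_on_compose2[OF Ck_iterated_deriv(2)[OF open_D F_Ck[OF assms(1,2)] assms(3)] this]
  show ?thesis by simp
qed

lemma perturbed_field_continuous_on:
  assumes "j \<in> {1..n}" "\<bar>\<epsilon>\<bar> \<le> \<epsilon>\<^sub>1" "continuous_on A x" "x ` A \<subseteq> D"
  shows "continuous_on A (\<lambda>s. perturbed_field k F R \<epsilon> j s (x s))"
proof -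
  have "continuous_on A (\<lambda>s. F i j s (x s))" if "i \<le> k" for i
    using F_deriv_continuous_on[OF that assms(1) _ assms(3,4), of 0] by simp
  moreover have "continuous_on A (\<lambda>s. R j s (x s) \<epsilon>)"
  proof -
    have "continuous_on A (\<lambda>s. (s, x s, \<epsilon>))" "(\<lambda>s. (s, x s, \<epsilon>)) ` A \<subseteq> UNIV \<times> D \<times> {-\<epsilon>\<^sub>0<..<\<epsilon>\<^sub>0}"
      using assms \<epsilon>\<^sub>1 by (auto intro!: continuous_intros)
    from continuous_on_compose2[OF Ck_continuous_on[OF R_Ck[OF assms(1)]] this]
    show ?thesis by simp
  qed
  ultimately show ?thesis
    unfolding perturbed_field_def by (intro continuous_intros) auto
qed

text \<open>One constant serves all zones, orders and angles: the derivatives form a finite family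
  indexed by triples \<open>(i, j, L)\<close>, each continuous on the compact box of one turn times
  \<open>{a..b}\<close>. Order \<open>k + 1\<close> is included for the Lagrange remainder of
  \<open>F 0\<close>.\<close>

lemma compact_bounds:
  assumes "{a..b} \<subseteq> D"
  obtains B where "B \<ge> 0"
    and "\<And>i j L s r. i \<le> k \<Longrightarrow> j \<in> {1..n} \<Longrightarrow> L \<le> k + 1 \<Longrightarrow> s \<in> {0..2 * pi} \<Longrightarrow> r \<in> {a..b} \<Longrightarrow>
      \<bar>(deriv ^^ L) (F i j s) r\<bar> \<le> B"
    and "\<And>j s r \<epsilon>. j \<in> {1..n} \<Longrightarrow> s \<in> {0..2 * pi} \<Longrightarrow> r \<in> {a..b} \<Longrightarrow> \<bar>\<epsilon>\<bar> \<le> \<epsilon>\<^sub>1 \<Longrightarrow> \<bar>R j s r \<epsilon>\<bar> \<le> B"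
    and "\<And>j s r r' \<epsilon>. j \<in> {1..n} \<Longrightarrow> s \<in> {0..2 * pi} \<Longrightarrow> r \<in> {a..b} \<Longrightarrow> r' \<in> {a..b} \<Longrightarrow> \<bar>\<epsilon>\<bar> \<le> \<epsilon>\<^sub>1 \<Longrightarrow>
      \<bar>R j s r \<epsilon> - R j s r' \<epsilon>\<bar> \<le> B * \<bar>r - r'\<bar>"
proof -
  let ?K = "{0..2 * pi} \<times> {a..b}" and ?K' = "{0..2 * pi} \<times> {a..b} \<times> {-\<epsilon>\<^sub>1..\<epsilon>\<^sub>1}"
  have K': "?K' \<subseteq> UNIV \<times> D \<times> {-\<epsilon>\<^sub>0<..<\<epsilon>\<^sub>0}" using assms \<epsilon>\<^sub>1 by auto
  have "continuous_on ?K (case i of (i, j, L) \<Rightarrow> \<lambda>(s, r). (deriv ^^ L) (F i j s) r)"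
    if "i \<in> {..k} \<times> {1..n} \<times> {..k + 1}" for i
  proof -
    obtain i' j L where i: "i = (i', j, L)" by (cases i) auto
    have "i' \<le> k" "j \<in> {1..n}" "L \<le> k + 1" using that by (auto simp: i)
    then have "continuous_on (UNIV \<times> D) (\<lambda>(s, r). (deriv ^^ L) (F i' j s) r)"
      using Ck_iterated_deriv(2)[OF open_D F_Ck] by simp
    then show ?thesis
      unfolding i prod.case by (rule continuous_on_subset) (use assms in auto)
  qed
  then obtain B1 where B1: "B1 \<ge> 0" "\<And>i x. i \<in> {..k} \<times> {1..n} \<times> {..k + 1} \<Longrightarrow> x \<in> ?K \<Longrightarrow>
      \<bar>(case i of (i, j, L) \<Rightarrow> \<lambda>(s, r). (deriv ^^ L) (F i j s) r) x\<bar> \<le> B1"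
    by (rule bounded_family_on_compact[of "{..k} \<times> {1..n} \<times> {..k + 1}" ?K
        "\<lambda>i. case i of (i, j, L) \<Rightarrow> \<lambda>(s, r). (deriv ^^ L) (F i j s) r", rotated 2])
      (auto intro: compact_Times)
  have "continuous_on ?K' (\<lambda>(s, r, \<epsilon>). R j s r \<epsilon>)" if "j \<in> {1..n}" for j
    using continuous_on_subset[OF Ck_continuous_on[OF R_Ck[OF that]] K'] .
  then obtain B2 where B2: "B2 \<ge> 0" "\<And>j x. j \<in> {1..n} \<Longrightarrow> x \<in> ?K' \<Longrightarrow> \<bar>(\<lambda>(s, r, \<epsilon>). R j s r \<epsilon>) x\<bar> \<le> B2"
    by (rule bounded_family_on_compact[of "{1..n}" ?K' "\<lambda>j. \<lambda>(s, r, \<epsilon>). R j s r \<epsilon>", rotated 2])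
      (auto intro: compact_Times)
  have "\<exists>R'. continuous_on (UNIV \<times> D \<times> {-\<epsilon>\<^sub>0<..<\<epsilon>\<^sub>0}) (\<lambda>(s, r, \<epsilon>). R' s r \<epsilon>) \<and>
      (\<forall>s r \<epsilon>. r \<in> D \<longrightarrow> \<epsilon> \<in> {-\<epsilon>\<^sub>0<..<\<epsilon>\<^sub>0} \<longrightarrow> ((\<lambda>r. R j s r \<epsilon>) has_real_derivative R' s r \<epsilon>) (at r))"
    if "j \<in> {1..n}" for j
    using Ck_middle_partial_derivative[of k "R j" D "{-\<epsilon>\<^sub>0<..<\<epsilon>\<^sub>0}"] R_Ck[OF that] by (metis Suc_eq_plus1)
  then obtain R' where R': "\<And>j. j \<in> {1..n} \<Longrightarrow> continuous_on (UNIV \<times> D \<times> {-\<epsilon>\<^sub>0<..<\<epsilon>\<^sub>0}) (\<lambda>(s, r, \<epsilon>). R' j s r \<epsilon>)"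
      "\<And>j s r \<epsilon>. j \<in> {1..n} \<Longrightarrow> r \<in> D \<Longrightarrow> \<epsilon> \<in> {-\<epsilon>\<^sub>0<..<\<epsilon>\<^sub>0} \<Longrightarrow>
        ((\<lambda>r. R j s r \<epsilon>) has_real_derivative R' j s r \<epsilon>) (at r)"
    by metis
  have "continuous_on ?K' (\<lambda>(s, r, \<epsilon>). R' j s r \<epsilon>)" if "j \<in> {1..n}" for j
    using continuous_on_subset[OF R'(1)[OF that] K'] .
  then obtain B3 where B3: "B3 \<ge> 0" "\<And>j x. j \<in> {1..n} \<Longrightarrow> x \<in> ?K' \<Longrightarrow> \<bar>(\<lambda>(s, r, \<epsilon>). R' j s r \<epsilon>) x\<bar> \<le> B3"
    by (rule bounded_family_on_compact[of "{1..n}" ?K' "\<lambda>j. \<lambda>(s, r, \<epsilon>). R' j s r \<epsilon>", rotated 2])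
      (auto intro: compact_Times)
  show ?thesis
  proof (rule that[of "max B1 (max B2 B3)"])
    show "max B1 (max B2 B3) \<ge> 0" using B1(1) by simp
    show "\<bar>(deriv ^^ L) (F i j s) r\<bar> \<le> max B1 (max B2 B3)"
      if "i \<le> k" "j \<in> {1..n}" "L \<le> k + 1" "s \<in> {0..2 * pi}" "r \<in> {a..b}" for i j L s r
      using B1(2)[of "(i, j, L)" "(s, r)"] that by auto
    show "\<bar>R j s r \<epsilon>\<bar> \<le> max B1 (max B2 B3)"
      if "j \<in> {1..n}" "s \<in> {0..2 * pi}" "r \<in> {a..b}" "\<bar>\<epsilon>\<bar> \<le> \<epsilon>\<^sub>1" for j s r \<epsilon>
    proof -
      have "(s, r, \<epsilon>) \<in> ?K'" using that by (auto simp: abs_le_iff)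
      from B2(2)[OF that(1) this] show ?thesis by auto
    qed
    show "\<bar>R j s r \<epsilon> - R j s r' \<epsilon>\<bar> \<le> max B1 (max B2 B3) * \<bar>r - r'\<bar>"
      if "j \<in> {1..n}" "s \<in> {0..2 * pi}" "r \<in> {a..b}" "r' \<in> {a..b}" "\<bar>\<epsilon>\<bar> \<le> \<epsilon>\<^sub>1" for j s r r' \<epsilon>
      unfolding real_norm_def [symmetric]
    proof (rule field_differentiable_bound[of "{a..b}" "\<lambda>r. R j s r \<epsilon>" "\<lambda>r. R' j s r \<epsilon>"])
      show "((\<lambda>r. R j s r \<epsilon>) has_real_derivative R' j s r \<epsilon>) (at r within {a..b})" if "r \<in> {a..b}" for r
        by (rule has_field_derivative_at_within, rule R'(2))
          (use \<open>j \<in> {1..n}\<close> \<open>\<bar>\<epsilon>\<bar> \<le> \<epsilon>\<^sub>1\<close> that assms \<epsilon>\<^sub>1 in auto)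
      show "norm (R' j s r \<epsilon>) \<le> max B1 (max B2 B3)" if "r \<in> {a..b}" for r
      proof -
        have "(s, r, \<epsilon>) \<in> ?K'" using that \<open>\<bar>\<epsilon>\<bar> \<le> \<epsilon>\<^sub>1\<close> \<open>s \<in> {0..2 * pi}\<close> by (auto simp: abs_le_iff)
        from B3(2)[OF \<open>j \<in> {1..n}\<close> this] show ?thesis by auto
      qed
    qed (use that in auto)
  qed
qed

lemma perturbed_field_bounds:
  assumes "{a..b} \<subseteq> D"
  obtains C where "C \<ge> 0"
    and "\<And>\<epsilon> j s r r'. \<bar>\<epsilon>\<bar> \<le> \<epsilon>\<^sub>1 \<Longrightarrow> j \<in> {1..n} \<Longrightarrow> s \<in> {0..2 * pi} \<Longrightarrow> r \<in> {a..b} \<Longrightarrow> r' \<in> {a..b} \<Longrightarrow>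
      \<bar>perturbed_field k F R \<epsilon> j s r - perturbed_field k F R \<epsilon> j s r'\<bar> \<le> C * \<bar>r - r'\<bar>"
    and "\<And>\<epsilon> j s r. \<bar>\<epsilon>\<bar> \<le> \<epsilon>\<^sub>1 \<Longrightarrow> j \<in> {1..n} \<Longrightarrow> s \<in> {0..2 * pi} \<Longrightarrow> r \<in> {a..b} \<Longrightarrow>
      \<bar>perturbed_field k F R \<epsilon> j s r - F 0 j s r\<bar> \<le> C * \<bar>\<epsilon>\<bar>"
proof -
  obtain B where B: "B \<ge> 0"
    "\<And>i j L s r. i \<le> k \<Longrightarrow> j \<in> {1..n} \<Longrightarrow> L \<le> k + 1 \<Longrightarrow> s \<in> {0..2 * pi} \<Longrightarrow> r \<in> {a..b} \<Longrightarrow>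
      \<bar>(deriv ^^ L) (F i j s) r\<bar> \<le> B"
    "\<And>j s r \<epsilon>. j \<in> {1..n} \<Longrightarrow> s \<in> {0..2 * pi} \<Longrightarrow> r \<in> {a..b} \<Longrightarrow> \<bar>\<epsilon>\<bar> \<le> \<epsilon>\<^sub>1 \<Longrightarrow> \<bar>R j s r \<epsilon>\<bar> \<le> B"
    "\<And>j s r r' \<epsilon>. j \<in> {1..n} \<Longrightarrow> s \<in> {0..2 * pi} \<Longrightarrow> r \<in> {a..b} \<Longrightarrow> r' \<in> {a..b} \<Longrightarrow> \<bar>\<epsilon>\<bar> \<le> \<epsilon>\<^sub>1 \<Longrightarrow>
      \<bar>R j s r \<epsilon> - R j s r' \<epsilon>\<bar> \<le> B * \<bar>r - r'\<bar>"
    by (rule compact_bounds[OF assms], rule that)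
  show ?thesis
  \<comment> \<open>There are \<open>k + 1\<close> fields \<open>F i\<close> plus the remainder
    \<open>R\<close>, each contributing at most \<open>B\<close>.\<close>
  proof (rule that[of "real (k + 2) * B"])
    show "real (k + 2) * B \<ge> 0" using B(1) by simp
    fix \<epsilon> j s r assume \<epsilon>: "\<bar>\<epsilon>\<bar> \<le> \<epsilon>\<^sub>1" and j: "j \<in> {1..n}" and s: "s \<in> {0..2 * pi}" and r: "r \<in> {a..b}"
    have \<epsilon>1: "\<bar>\<epsilon>\<bar> \<le> 1" using \<epsilon> \<epsilon>\<^sub>1 by simp
    show "\<bar>perturbed_field k F R \<epsilon> j s r - perturbed_field k F R \<epsilon> j s r'\<bar> \<le> real (k + 2) * B * \<bar>r - r'\<bar>"
      if r': "r' \<in> {a..b}" for r'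
    proof -
      have F: "\<bar>F i j s r - F i j s r'\<bar> \<le> B * \<bar>r - r'\<bar>" if "i \<le> k" for i
        unfolding real_norm_def [symmetric]
      proof (rule field_differentiable_bound[of "{a..b}" "F i j s" "deriv (F i j s)"])
        show "(F i j s has_real_derivative deriv (F i j s) r) (at r within {a..b})" if "r \<in> {a..b}" for r
          by (rule has_field_derivative_at_within) (use F_deriv[OF \<open>i \<le> k\<close> j, of 0 r s] that assms in auto)
        show "norm (deriv (F i j s) r) \<le> B" if "r \<in> {a..b}" for r
          using B(2)[OF \<open>i \<le> k\<close> j _ s that, of 1] by simp
      qed (use r r' in auto)
      have le: "\<bar>\<epsilon> ^ i * x\<bar> \<le> y" if "\<bar>x\<bar> \<le> y" for i x and y :: real
        using that \<epsilon>1 mult_mono[of "\<bar>\<epsilon>\<bar> ^ i" 1 "\<bar>x\<bar>" y] by (auto simp: abs_mult power_abs power_le_one)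
      have "perturbed_field k F R \<epsilon> j s r - perturbed_field k F R \<epsilon> j s r' =
        (\<Sum>i = 0..k. \<epsilon> ^ i * (F i j s r - F i j s r')) + \<epsilon> ^ (k + 1) * (R j s r \<epsilon> - R j s r' \<epsilon>)"
        by (simp add: perturbed_field_def sum_subtractf algebra_simps)
      also have "\<bar>\<dots>\<bar> \<le> (\<Sum>i = 0..k. B * \<bar>r - r'\<bar>) + B * \<bar>r - r'\<bar>"
        by (intro order.trans[OF abs_triangle_ineq] add_mono order.trans[OF sum_abs sum_mono] le F B(4) j s r r' \<epsilon>) auto
      finally show ?thesis by (simp add: algebra_simps)
    qed
    have le: "\<bar>\<epsilon> ^ i * x\<bar> \<le> B * \<bar>\<epsilon>\<bar>" if "\<bar>x\<bar> \<le> B" "i \<ge> 1" for i x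
    proof -
      have "\<bar>\<epsilon>\<bar> ^ i \<le> \<bar>\<epsilon>\<bar> ^ 1" using \<epsilon>1 that(2) by (intro power_decreasing) auto
      then have "\<bar>\<epsilon>\<bar> ^ i * \<bar>x\<bar> \<le> \<bar>\<epsilon>\<bar> * B" using that by (intro mult_mono) auto
      then show ?thesis by (simp add: abs_mult power_abs mult.commute)
    qed
    have "perturbed_field k F R \<epsilon> j s r - F 0 j s r =
        (\<Sum>i = 1..k. \<epsilon> ^ i * F i j s r) + \<epsilon> ^ (k + 1) * R j s r \<epsilon>"
      by (simp add: perturbed_field_def sum.atLeast_Suc_atMost)
    also have "\<bar>\<dots>\<bar> \<le> (\<Sum>i = 1..k. B * \<bar>\<epsilon>\<bar>) + B * \<bar>\<epsilon>\<bar>"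
      by (intro order.trans[OF abs_triangle_ineq] add_mono order.trans[OF sum_abs sum_mono] le B(3) j s r \<epsilon>)
        (use B(2)[OF _ j _ s r, of _ 0] in auto)
    also have "\<dots> \<le> real (k + 2) * B * \<bar>\<epsilon>\<bar>"
      using B(1) by (simp add: algebra_simps)
    finally show "\<bar>perturbed_field k F R \<epsilon> j s r - F 0 j s r\<bar> \<le> real (k + 2) * B * \<bar>\<epsilon>\<bar>" .
  qed
qed

text \<open>
  The coefficient of \<open>\<epsilon>\<^sup>q\<close> in the Taylor expansion of the field of zone \<open>j\<close> along
  \<open>c + \<Sum>\<^sub>m \<epsilon>\<^sup>m z\<^sub>m / m!\<close>; the summand \<open>l = 0\<close> is \<open>F\<^sub>q\<close> itself.
\<close>

definition field_coeff :: "nat \<Rightarrow> nat \<Rightarrow> real \<Rightarrow> real \<Rightarrow> (nat \<Rightarrow> real) \<Rightarrow> real" where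
  "field_coeff q j s c z = (\<Sum>l\<le>q. faa_di_bruno l (\<lambda>L. (deriv ^^ L) (F (q - l) j s) c) z)"

text \<open>As \<open>F i\<close> carries the factor \<open>\<epsilon> ^ i\<close>, expanding it to
  order \<open>k - i\<close> already leaves an error of order \<open>k + 1\<close>, within the
  smoothness available. The constant is uniform in the angle, the base point and the coefficients
  \<open>z\<close>.\<close>

lemma perturbed_field_expansion:
  fixes Z :: real
  assumes ab: "{a..b} \<subseteq> D" and "Z \<ge> 0"
  obtains C where "C \<ge> 0"
    and "\<And>\<epsilon> j s c z. \<bar>\<epsilon>\<bar> \<le> \<epsilon>\<^sub>1 \<Longrightarrow> j \<in> {1..n} \<Longrightarrow> s \<in> {0..2 * pi} \<Longrightarrow> c \<in> {a..b} \<Longrightarrow>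
      \<forall>m\<in>{1..k}. \<bar>z m\<bar> \<le> Z \<Longrightarrow> c + (\<Sum>m = 1..k. \<epsilon> ^ m * (z m / fact m)) \<in> {a..b} \<Longrightarrow>
      \<bar>perturbed_field k F R \<epsilon> j s (c + (\<Sum>m = 1..k. \<epsilon> ^ m * (z m / fact m))) -
        (\<Sum>q\<le>k. \<epsilon> ^ q * field_coeff q j s c z)\<bar> \<le> C * \<bar>\<epsilon>\<bar> ^ (k + 1)"
proof -
  obtain B where B: "B \<ge> 0"
    "\<And>i j L s r. i \<le> k \<Longrightarrow> j \<in> {1..n} \<Longrightarrow> L \<le> k + 1 \<Longrightarrow> s \<in> {0..2 * pi} \<Longrightarrow> r \<in> {a..b} \<Longrightarrow>
      \<bar>(deriv ^^ L) (F i j s) r\<bar> \<le> B"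
    "\<And>j s r \<epsilon>. j \<in> {1..n} \<Longrightarrow> s \<in> {0..2 * pi} \<Longrightarrow> r \<in> {a..b} \<Longrightarrow> \<bar>\<epsilon>\<bar> \<le> \<epsilon>\<^sub>1 \<Longrightarrow> \<bar>R j s r \<epsilon>\<bar> \<le> B"
    by (rule compact_bounds[OF ab], rule that)
  define P where "P N C \<longleftrightarrow> C \<ge> 0 \<and>
    (\<forall>a z \<epsilon>. (\<forall>L\<le>N. \<bar>a L\<bar> \<le> B) \<longrightarrow> (\<forall>m\<in>{1..k}. \<bar>z m\<bar> \<le> Z) \<longrightarrow> \<bar>\<epsilon>\<bar> \<le> 1 \<longrightarrow>
      \<bar>(\<Sum>L\<le>N. a L / fact L * (\<Sum>m = 1..k. \<epsilon> ^ m * (z m / fact m)) ^ L) -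
        (\<Sum>l\<le>N. \<epsilon> ^ l * faa_di_bruno l a z)\<bar> \<le> C * \<bar>\<epsilon>\<bar> ^ (N + 1))" for N C
  have "\<forall>N\<in>{..k}. \<exists>C. P N C"
  proof
    fix N assume "N \<in> {..k}"
    then have "N \<le> k" by simp
    from faa_di_bruno_remainder[OF this \<open>B \<ge> 0\<close> \<open>Z \<ge> 0\<close>] show "\<exists>C. P N C"
      unfolding P_def by blast
  qed
  then obtain Cr where P: "P N (Cr N)" if "N \<le> k" for N
    using bchoice[of "{..k}" P] by auto
  have Cr: "Cr N \<ge> 0" if "N \<le> k" for N
    using P[OF that] by (simp add: P_def)
  \<comment> \<open>The first summand is the Lagrange remainder, with the increment \<open>h\<close>
    at most \<open>real k * Z * \<bar>\<epsilon>\<bar>\<close>; the second collects the monomials of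
    weight above \<open>k - i\<close>.\<close>
  define Ci where "Ci i = B * (real k * Z) ^ (k - i + 1) + Cr (k - i)" for i
  have Ci: "Ci i \<ge> 0" for i
    using Cr[of "k - i"] \<open>B \<ge> 0\<close> \<open>Z \<ge> 0\<close> by (simp add: Ci_def)
  show ?thesis
  proof (rule that[of "(\<Sum>i\<le>k. Ci i) + B"])
    show "(\<Sum>i\<le>k. Ci i) + B \<ge> 0" using Ci \<open>B \<ge> 0\<close> by (intro add_nonneg_nonneg sum_nonneg)
    fix \<epsilon> j s c and z :: "nat \<Rightarrow> real"
    assume \<epsilon>: "\<bar>\<epsilon>\<bar> \<le> \<epsilon>\<^sub>1" and j: "j \<in> {1..n}" and s: "s \<in> {0..2 * pi}" and c: "c \<in> {a..b}"
      and z: "\<forall>m\<in>{1..k}. \<bar>z m\<bar> \<le> Z"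
    define h where "h = (\<Sum>m = 1..k. \<epsilon> ^ m * (z m / fact m))"
    assume "c + (\<Sum>m = 1..k. \<epsilon> ^ m * (z m / fact m)) \<in> {a..b}"
    then have ch: "c + h \<in> {a..b}" by (simp add: h_def)
    have \<epsilon>1: "\<bar>\<epsilon>\<bar> \<le> 1" using \<epsilon> \<epsilon>\<^sub>1 by simp
    have h: "\<bar>h\<bar> \<le> real k * Z * \<bar>\<epsilon>\<bar>"
      unfolding h_def by (rule sum_powers_le[OF \<epsilon>1]) (use z in blast)
    define T where "T i l = faa_di_bruno l (\<lambda>L. (deriv ^^ L) (F i j s) c) z" for i l
    have Fi: "\<bar>F i j s (c + h) - (\<Sum>l\<le>k - i. \<epsilon> ^ l * T i l)\<bar> \<le> Ci i * \<bar>\<epsilon>\<bar> ^ (k - i + 1)"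
      if i: "i \<le> k" for i
    proof -
      have "\<bar>F i j s (c + h) - (\<Sum>L\<le>k - i. (deriv ^^ L) (F i j s) c / fact L * (c + h - c) ^ L)\<bar>
          \<le> B * \<bar>c + h - c\<bar> ^ (k - i + 1)"
        by (rule taylor_iterated_deriv_bound[where a = a and b = b])
          (use F_deriv[OF i j] B(2)[OF i j _ s] c ch ab in \<open>auto simp del: funpow.simps\<close>)
      also have "\<dots> \<le> B * (real k * Z * \<bar>\<epsilon>\<bar>) ^ (k - i + 1)"
        using h \<open>B \<ge> 0\<close> by (intro mult_left_mono power_mono) auto
      finally have 1: "\<bar>F i j s (c + h) - (\<Sum>L\<le>k - i. (deriv ^^ L) (F i j s) c / fact L * h ^ L)\<bar>
          \<le> B * (real k * Z) ^ (k - i + 1) * \<bar>\<epsilon>\<bar> ^ (k - i + 1)"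
        by (simp only: power_mult_distrib mult.assoc add_diff_cancel_left')
      have 2: "\<bar>(\<Sum>L\<le>k - i. (deriv ^^ L) (F i j s) c / fact L * h ^ L) - (\<Sum>l\<le>k - i. \<epsilon> ^ l * T i l)\<bar>
          \<le> Cr (k - i) * \<bar>\<epsilon>\<bar> ^ (k - i + 1)"
        unfolding T_def h_def using P[of "k - i"] B(2)[OF i j _ s c] z \<epsilon>1 by (simp add: P_def)
      show ?thesis
        using 1 2 unfolding Ci_def distrib_right by linarith
    qed
    have "(\<Sum>q\<le>k. \<epsilon> ^ q * field_coeff q j s c z) = (\<Sum>q\<le>k. \<Sum>l\<le>q. \<epsilon> ^ (q - l) * (\<epsilon> ^ l * T (q - l) l))"
      unfolding field_coeff_def T_def sum_distrib_left
      by (intro sum.cong refl) (simp add: mult.assoc [symmetric] power_add [symmetric])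
    also have "\<dots> = (\<Sum>(q, l)\<in>Sigma {..k} (\<lambda>q. {..q}). \<epsilon> ^ (q - l) * (\<epsilon> ^ l * T (q - l) l))"
      by (rule sum.Sigma) auto
    \<comment> \<open>The total order \<open>q\<close> is the explicit order \<open>i\<close> of the
      field plus the weight \<open>l\<close> produced by its Taylor expansion.\<close>
    also have "\<dots> = (\<Sum>(i, l)\<in>Sigma {..k} (\<lambda>i. {..k - i}). \<epsilon> ^ i * (\<epsilon> ^ l * T i l))"
      by (rule sum.reindex_bij_witness[of _ "\<lambda>(i, l). (i + l, l)" "\<lambda>(q, l). (q - l, l)"]) auto
    also have "\<dots> = (\<Sum>i\<le>k. \<Sum>l\<le>k - i. \<epsilon> ^ i * (\<epsilon> ^ l * T i l))"
      by (rule sum.Sigma [symmetric]) auto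
    also have "\<dots> = (\<Sum>i\<le>k. \<epsilon> ^ i * (\<Sum>l\<le>k - i. \<epsilon> ^ l * T i l))"
      by (simp add: sum_distrib_left)
    finally have "perturbed_field k F R \<epsilon> j s (c + h) - (\<Sum>q\<le>k. \<epsilon> ^ q * field_coeff q j s c z) =
        (\<Sum>i\<le>k. \<epsilon> ^ i * (F i j s (c + h) - (\<Sum>l\<le>k - i. \<epsilon> ^ l * T i l))) + \<epsilon> ^ (k + 1) * R j s (c + h) \<epsilon>"
      by (simp add: perturbed_field_def right_diff_distrib sum_subtractf atMost_atLeast0)
    also have "\<bar>\<dots>\<bar> \<le> (\<Sum>i\<le>k. Ci i * \<bar>\<epsilon>\<bar> ^ (k + 1)) + B * \<bar>\<epsilon>\<bar> ^ (k + 1)"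
    proof (intro order.trans[OF abs_triangle_ineq] add_mono order.trans[OF sum_abs sum_mono])
      fix i assume "i \<in> {..k}"
      then have i: "i \<le> k" by simp
      have "\<bar>\<epsilon> ^ i * (F i j s (c + h) - (\<Sum>l\<le>k - i. \<epsilon> ^ l * T i l))\<bar> \<le> \<bar>\<epsilon>\<bar> ^ i * (Ci i * \<bar>\<epsilon>\<bar> ^ (k - i + 1))"
        unfolding abs_mult power_abs by (intro mult_left_mono Fi i) auto
      also have "\<dots> = Ci i * (\<bar>\<epsilon>\<bar> ^ i * \<bar>\<epsilon>\<bar> ^ (k - i + 1))" by simp
      also have "\<bar>\<epsilon>\<bar> ^ i * \<bar>\<epsilon>\<bar> ^ (k - i + 1) = \<bar>\<epsilon>\<bar> ^ (k + 1)"
        using i unfolding power_add [symmetric] by simp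
      finally show "\<bar>\<epsilon> ^ i * (F i j s (c + h) - (\<Sum>l\<le>k - i. \<epsilon> ^ l * T i l))\<bar> \<le> Ci i * \<bar>\<epsilon>\<bar> ^ (k + 1)" .
    next
      have "\<bar>\<epsilon>\<bar> ^ (k + 1) * \<bar>R j s (c + h) \<epsilon>\<bar> \<le> \<bar>\<epsilon>\<bar> ^ (k + 1) * B"
        by (intro mult_left_mono B(3) j s ch \<epsilon>) auto
      then show "\<bar>\<epsilon> ^ (k + 1) * R j s (c + h) \<epsilon>\<bar> \<le> B * \<bar>\<epsilon>\<bar> ^ (k + 1)"
        unfolding abs_mult power_abs by (simp only: mult.commute)
    qed
    also have "\<dots> = ((\<Sum>i\<le>k. Ci i) + B) * \<bar>\<epsilon>\<bar> ^ (k + 1)"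
      by (simp only: sum_distrib_right distrib_right)
    finally show "\<bar>perturbed_field k F R \<epsilon> j s (c + (\<Sum>m = 1..k. \<epsilon> ^ m * (z m / fact m))) -
        (\<Sum>q\<le>k. \<epsilon> ^ q * field_coeff q j s c z)\<bar> \<le> ((\<Sum>i\<le>k. Ci i) + B) * \<bar>\<epsilon>\<bar> ^ (k + 1)"
      unfolding h_def .
  qed
qed

section \<open>The recurrence in terms of Taylor coefficients\<close>

lemma field_coeff_0: "field_coeff 0 j s c z = F 0 j s c"
  by (simp add: field_coeff_def faa_di_bruno_0)

lemma piecewise_field_coeff:
  "piecewise n \<alpha> (\<lambda>j s c. field_coeff q j s c (z s)) s c =
    (\<Sum>l\<le>q. faa_di_bruno l (\<lambda>L. pw_deriv n \<alpha> (F (q - l)) L s c) (z s))"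
  unfolding pw_deriv_def piecewise_def field_coeff_def faa_di_bruno_sum sum_distrib_left
  by (rule sum.swap)

text \<open>Dividing by the factorial exposes the recurrence as the order-\<open>q\<close> part of
  an integral equation for the polynomial approximation. Order 1 has its own equation; for larger
  \<open>q\<close> the isolated \<open>F q\<close> is the summand \<open>l = 0\<close>.\<close>

lemma averaging_system_integral:
  assumes av: "averaging_system n k \<alpha> D F \<phi> y" and "\<rho> \<in> D" "q \<in> {1..k}" "t \<in> {0..2 * pi}"
  shows "y q t \<rho> / fact q =
    integral {0..t} (\<lambda>s. piecewise n \<alpha> (\<lambda>j s c. field_coeff q j s c (\<lambda>m. y m s \<rho>)) s (\<phi> s \<rho>))"
proof (cases "q = 1")
  case True
  have "y 1 t \<rho> = integral {0..t} (\<lambda>s.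
      piecewise n \<alpha> (F 1) s (\<phi> s \<rho>) + pw_deriv n \<alpha> (F 0) 1 s (\<phi> s \<rho>) * y 1 s \<rho>)"
    using assms by (simp add: averaging_system_def)
  also have "\<dots> = integral {0..t} (\<lambda>s.
      piecewise n \<alpha> (\<lambda>j s c. field_coeff 1 j s c (\<lambda>m. y m s \<rho>)) s (\<phi> s \<rho>))"
    unfolding piecewise_field_coeff
    by (rule integral_cong) (simp add: faa_di_bruno_0 faa_di_bruno_1 pw_deriv_def)
  finally show ?thesis by (simp add: True)
next
  case False
  then have q: "q \<in> {2..k}" using assms by auto
  have split: "(\<Sum>l\<le>q. faa_di_bruno l (A l) b) = A 0 0 + (\<Sum>l = 1..q. faa_di_bruno l (A l) b)" for A b
    by (simp add: atMost_atLeast0 sum.atLeast_Suc_atMost faa_di_bruno_0)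
  from q have "y q t \<rho> = fact q * integral {0..t} (\<lambda>s.
             piecewise n \<alpha> (F q) s (\<phi> s \<rho>) +
             (\<Sum>l = 1..q. \<Sum>b \<in> S_tuples l.
                1 / (\<Prod>m = 1..l. fact (b m) * fact m ^ b m) *
                pw_deriv n \<alpha> (F (q - l)) (\<Sum>m = 1..l. b m) s (\<phi> s \<rho>) *
                (\<Prod>m = 1..l. y m s \<rho> ^ b m)))"
    using assms by (simp add: averaging_system_def)
  also have "\<dots> = fact q * integral {0..t} (\<lambda>s.
      piecewise n \<alpha> (\<lambda>j s c. field_coeff q j s c (\<lambda>m. y m s \<rho>)) s (\<phi> s \<rho>))"
    unfolding piecewise_field_coeff split
    unfolding faa_di_bruno_def
    by (intro arg_cong2[of _ _ _ _ "(*)"] integral_cong refl) (simp only: pw_deriv_def funpow_0 diff_zero)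
  finally show ?thesis by simp
qed

lemma field_coeff_continuous_on:
  assumes "q \<le> k" "j \<in> {1..n}" "continuous_on A c" "c ` A \<subseteq> D"
    and "\<And>m. m \<in> {1..k} \<Longrightarrow> continuous_on A (\<lambda>s. z s m)"
  shows "continuous_on A (\<lambda>s. field_coeff q j s (c s) (z s))"
  unfolding field_coeff_def
proof (intro continuous_on_sum faa_di_bruno_continuous_on)
  fix l assume l: "l \<in> {..q}"
  show "continuous_on A (\<lambda>s. (deriv ^^ L) (F (q - l) j s) (c s))" if "L \<le> l" for L
    by (rule F_deriv_continuous_on) (use assms l that in auto)
  show "continuous_on A (\<lambda>s. z s m)" if "m \<in> {1..l}" for m
    by (rule assms(5)) (use assms(1) l that in auto)
qed

section \<open>Expansion of the displacement after one turn\<close>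

lemma solution_expansion:
  assumes av: "averaging_system n k \<alpha> D F \<phi> y" and \<rho>: "\<rho> \<in> D" "\<phi> 0 \<rho> = \<rho>"
    and sol: "pw_solution n \<alpha> D (F 0) (\<lambda>\<theta>. \<phi> \<theta> \<rho>)" and ab: "{a..b} \<subseteq> D"
  obtains C e where "C \<ge> 0" "e > 0" and "\<And>\<epsilon> x. \<bar>\<epsilon>\<bar> \<le> e \<Longrightarrow>
      pw_solution n \<alpha> D (perturbed_field k F R \<epsilon>) x \<Longrightarrow> x 0 = \<rho> \<Longrightarrow> (\<And>t. t \<in> {0..2 * pi} \<Longrightarrow> x t \<in> {a..b}) \<Longrightarrow>
      \<bar>x (2 * pi) - (\<phi> (2 * pi) \<rho> + (\<Sum>i = 1..k. \<epsilon> ^ i * averaged y i \<rho>))\<bar> \<le> C * \<bar>\<epsilon>\<bar> ^ (k + 1)"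
proof -
  let ?T = "2 * pi"
  define c where "c s = \<phi> s \<rho>" for s
  define z where "z s m = y m s \<rho>" for s m
  have c_cont: "continuous_on {0..?T} c" and cD: "c ` {0..?T} \<subseteq> D"
    using sol by (auto simp: pw_solution_def c_def)
  have z_cont: "continuous_on {0..?T} (\<lambda>s. z s m)" if "m \<in> {1..k}" for m
    using av \<rho> that by (simp add: averaging_system_def z_def)
  obtain Z where Z: "Z \<ge> 0" "\<And>m s. m \<in> {1..k} \<Longrightarrow> s \<in> {0..?T} \<Longrightarrow> \<bar>z s m\<bar> \<le> Z"
    by (rule bounded_family_on_compact[of "{1..k}" "{0..?T}" "\<lambda>m s. z s m"]) (auto simp: z_cont)
  \<comment> \<open>The interval built from this set has to contain the unperturbed orbit, its
    polynomial perturbation and the true solution at once; only then do the Lipschitz and Taylor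
    bounds apply to all three.\<close>
  have K: "compact (c ` {0..?T} \<union> {a..b})" "c ` {0..?T} \<union> {a..b} \<noteq> {}" "c ` {0..?T} \<union> {a..b} \<subseteq> D"
    using c_cont cD ab by (auto intro!: compact_Un compact_continuous_image)
  obtain a' b' \<eta> where \<eta>: "\<eta> > 0" and a'b': "{a'..b'} \<subseteq> D"
    and near: "\<And>x. x \<in> c ` {0..?T} \<union> {a..b} \<Longrightarrow> {x - \<eta>..x + \<eta>} \<subseteq> {a'..b'}"
    by (rule compact_interval_neighbourhood[OF open_D interval_D K], rule that)
  have near0: "x \<in> {a'..b'}" if "x \<in> c ` {0..?T} \<union> {a..b}" for x
    using near[OF that] \<eta> by force
  obtain L where L: "L \<ge> 0"
    "\<And>\<epsilon> j s r r'. \<bar>\<epsilon>\<bar> \<le> \<epsilon>\<^sub>1 \<Longrightarrow> j \<in> {1..n} \<Longrightarrow> s \<in> {0..?T} \<Longrightarrow> r \<in> {a'..b'} \<Longrightarrow> r' \<in> {a'..b'} \<Longrightarrow>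
      \<bar>perturbed_field k F R \<epsilon> j s r - perturbed_field k F R \<epsilon> j s r'\<bar> \<le> L * \<bar>r - r'\<bar>"
    by (rule perturbed_field_bounds[OF a'b'], rule that)
  obtain C where C: "C \<ge> 0"
    "\<And>\<epsilon> j s c z. \<bar>\<epsilon>\<bar> \<le> \<epsilon>\<^sub>1 \<Longrightarrow> j \<in> {1..n} \<Longrightarrow> s \<in> {0..?T} \<Longrightarrow> c \<in> {a'..b'} \<Longrightarrow>
      \<forall>m\<in>{1..k}. \<bar>z m\<bar> \<le> Z \<Longrightarrow> c + (\<Sum>m = 1..k. \<epsilon> ^ m * (z m / fact m)) \<in> {a'..b'} \<Longrightarrow>
      \<bar>perturbed_field k F R \<epsilon> j s (c + (\<Sum>m = 1..k. \<epsilon> ^ m * (z m / fact m))) -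
        (\<Sum>q\<le>k. \<epsilon> ^ q * field_coeff q j s c z)\<bar> \<le> C * \<bar>\<epsilon>\<bar> ^ (k + 1)"
    by (rule perturbed_field_expansion[OF a'b' Z(1)], rule that)
  \<comment> \<open>Chosen so that the polynomial stays within \<eta> of the unperturbed orbit; the
    added 1 excludes division by zero.\<close>
  define e where "e = min \<epsilon>\<^sub>1 (\<eta> / (real k * Z + 1))"
  have kZ: "real k * Z \<ge> 0" using Z(1) by simp
  have e: "e > 0" "e \<le> \<epsilon>\<^sub>1" "real k * Z * e \<le> \<eta>"
  proof -
    show "e > 0" "e \<le> \<epsilon>\<^sub>1" using \<epsilon>\<^sub>1 \<eta> kZ by (auto simp: e_def)
    have "real k * Z * e \<le> (real k * Z + 1) * e" using \<open>e > 0\<close> by simp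
    also have "\<dots> \<le> (real k * Z + 1) * (\<eta> / (real k * Z + 1))"
      using kZ by (intro mult_left_mono) (auto simp: e_def)
    also have "\<dots> = \<eta>" using kZ by simp
    finally show "real k * Z * e \<le> \<eta>" .
  qed
  show ?thesis
  proof (rule that[of "real n * C * ?T * exp (real n * L * ?T)" e])
    show "0 \<le> real n * C * ?T * exp (real n * L * ?T)" using C(1) by simp
    show "e > 0" by (rule e(1))
    fix \<epsilon> x assume \<epsilon>: "\<bar>\<epsilon>\<bar> \<le> e" and x: "pw_solution n \<alpha> D (perturbed_field k F R \<epsilon>) x" "x 0 = \<rho>"
      and xab: "\<And>t. t \<in> {0..?T} \<Longrightarrow> x t \<in> {a..b}"
    have \<epsilon>e: "\<bar>\<epsilon>\<bar> \<le> \<epsilon>\<^sub>1" and \<epsilon>1: "\<bar>\<epsilon>\<bar> \<le> 1" using \<epsilon> e \<epsilon>\<^sub>1 by auto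
    have x_cont: "continuous_on {0..?T} x" and xD: "x ` {0..?T} \<subseteq> D"
      using x by (auto simp: pw_solution_def)
    define p where "p s = c s + (\<Sum>m = 1..k. \<epsilon> ^ m * (z s m / fact m))" for s
    have p_cont: "continuous_on {0..?T} p"
      unfolding p_def by (intro continuous_intros c_cont z_cont) auto
    have p_ab: "p s \<in> {a'..b'}" if s: "s \<in> {0..?T}" for s
    proof -
      have "\<bar>\<Sum>m = 1..k. \<epsilon> ^ m * (z s m / fact m)\<bar> \<le> real k * Z * \<bar>\<epsilon>\<bar>"
        by (rule sum_powers_le[OF \<epsilon>1]) (use Z(2) s in auto)
      also have "\<dots> \<le> \<eta>" using \<epsilon> e(3) kZ by (meson mult_left_mono order.trans)
      finally have "p s \<in> {c s - \<eta>..c s + \<eta>}" by (auto simp: p_def abs_le_iff)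
      with near[of "c s"] s show ?thesis by blast
    qed
    define W where "W q j s u = field_coeff q j s u (z s)" for q j s u
    \<comment> \<open>The truncated expansion of the field, evaluated along the unperturbed orbit.
      The polynomial \<open>p\<close> satisfies the integral equation with integrand
      \<open>E\<close> exactly, so its defect in the perturbed equation is just the Taylor
      error.\<close>
    define E where "E j s u = (\<Sum>q\<le>k. \<epsilon> ^ q * W q j s u)" for j s u
    have zone_cont: "continuous_on {\<alpha> (j - 1)..\<alpha> j} g" if "continuous_on {0..?T} g" "j \<in> {1..n}" for j and g :: "real \<Rightarrow> real"
      using continuous_on_subset[OF that(1) zone_subset[OF that(2)]] .
    have W_cont: "continuous_on {0..?T} (\<lambda>s. W q j s (c s))" if "q \<le> k" "j \<in> {1..n}" for q j
      unfolding W_def using that by (intro field_coeff_continuous_on c_cont cD z_cont)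
    have E_cont: "continuous_on {0..?T} (\<lambda>s. E j s (c s))" if "j \<in> {1..n}" for j
      unfolding E_def by (intro continuous_intros W_cont that) auto
    have W_int: "(\<lambda>s. piecewise n \<alpha> (W q) s (c s)) integrable_on {0..?T}" if "q \<le> k" for q
      by (intro piecewise_integrable zone_cont W_cont that)
    have E_int: "(\<lambda>s. piecewise n \<alpha> E s (c s)) integrable_on {0..?T}"
      by (intro piecewise_integrable zone_cont E_cont)
    have f_int: "(\<lambda>s. piecewise n \<alpha> (perturbed_field k F R \<epsilon>) s (x s)) integrable_on {0..?T}"
      by (intro piecewise_integrable zone_cont perturbed_field_continuous_on \<epsilon>e x_cont xD)
    have E_eq: "piecewise n \<alpha> E s u = (\<Sum>q\<le>k. \<epsilon> ^ q * piecewise n \<alpha> (W q) s u)" for s u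
      unfolding piecewise_def E_def sum_distrib_left by (subst sum.swap) (simp add: mult.left_commute)
    have p_eq: "p t = \<rho> + integral {0..t} (\<lambda>s. piecewise n \<alpha> E s (c s))" if t: "t \<in> {0..?T}" for t
    proof -
      have int: "(\<lambda>s. piecewise n \<alpha> (W q) s (c s)) integrable_on {0..t}" if "q \<le> k" for q
        by (rule integrable_on_subinterval[OF W_int[OF that]]) (use t in auto)
      have "integral {0..t} (\<lambda>s. piecewise n \<alpha> E s (c s)) =
          (\<Sum>q\<le>k. \<epsilon> ^ q * integral {0..t} (\<lambda>s. piecewise n \<alpha> (W q) s (c s)))"
        unfolding E_eq by (subst integral_sum) (auto intro!: integrable_on_mult_right int)
      also have "\<dots> = integral {0..t} (\<lambda>s. piecewise n \<alpha> (W 0) s (c s)) +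
          (\<Sum>q = 1..k. \<epsilon> ^ q * integral {0..t} (\<lambda>s. piecewise n \<alpha> (W q) s (c s)))"
        by (simp add: atMost_atLeast0 sum.atLeast_Suc_atMost)
      also have "integral {0..t} (\<lambda>s. piecewise n \<alpha> (W 0) s (c s)) = c t - \<rho>"
        using pw_solution_imp_integral_equation[OF sol t] \<rho>(2)
        by (simp add: W_def field_coeff_0 c_def piecewise_def)
      also have "(\<Sum>q = 1..k. \<epsilon> ^ q * integral {0..t} (\<lambda>s. piecewise n \<alpha> (W q) s (c s))) =
          (\<Sum>q = 1..k. \<epsilon> ^ q * (z t q / fact q))"
        using averaging_system_integral[OF av \<rho>(1) _ t]
        by (intro sum.cong refl) (simp add: W_def z_def [abs_def] c_def piecewise_def)
      finally show ?thesis by (simp add: p_def)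
    qed
    \<comment> \<open>Both curves start at \<rho>, so only the defect of order \<open>k + 1\<close>
      is amplified.\<close>
    have "\<bar>x ?T - p ?T\<bar> \<le> (\<bar>\<rho> - \<rho>\<bar> + (real n * C * \<bar>\<epsilon>\<bar> ^ (k + 1)) * ?T) * exp (real n * L * ?T)"
    proof (rule integral_equation_comparison[OF _ p_eq f_int E_int x_cont p_cont])
      show "x t = \<rho> + integral {0..t} (\<lambda>s. piecewise n \<alpha> (perturbed_field k F R \<epsilon>) s (x s))" if "t \<in> {0..?T}" for t
        using pw_solution_imp_integral_equation[OF x(1) that] x(2) by simp
      fix s assume s: "s \<in> {0..?T}"
      have "\<bar>piecewise n \<alpha> (perturbed_field k F R \<epsilon>) s (x s) - piecewise n \<alpha> E s (c s)\<bar>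
          \<le> real n * (L * \<bar>x s - p s\<bar> + C * \<bar>\<epsilon>\<bar> ^ (k + 1))"
      proof (rule piecewise_diff_le)
        fix j assume j: "j \<in> {1..n}"
        have "\<bar>perturbed_field k F R \<epsilon> j s (x s) - perturbed_field k F R \<epsilon> j s (p s)\<bar> \<le> L * \<bar>x s - p s\<bar>"
          by (intro L(2) \<epsilon>e j s p_ab near0) (use xab s in auto)
        moreover have "\<bar>perturbed_field k F R \<epsilon> j s (p s) - E j s (c s)\<bar> \<le> C * \<bar>\<epsilon>\<bar> ^ (k + 1)"
          unfolding p_def E_def W_def
          by (intro C(2) \<epsilon>e j s near0 p_ab[unfolded p_def]) (use Z(2) s in auto)
        ultimately show "\<bar>perturbed_field k F R \<epsilon> j s (x s) - E j s (c s)\<bar> \<le> L * \<bar>x s - p s\<bar> + C * \<bar>\<epsilon>\<bar> ^ (k + 1)"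
          by linarith
      qed (use L(1) C(1) in simp)
      then show "\<bar>piecewise n \<alpha> (perturbed_field k F R \<epsilon>) s (x s) - piecewise n \<alpha> E s (c s)\<bar>
          \<le> real n * L * \<bar>x s - p s\<bar> + real n * C * \<bar>\<epsilon>\<bar> ^ (k + 1)"
        by (simp only: distrib_left mult.assoc)
    qed (use L(1) C(1) in auto)
    also have "\<dots> = real n * C * ?T * exp (real n * L * ?T) * \<bar>\<epsilon>\<bar> ^ (k + 1)"
      by (simp add: ac_simps)
    finally show "\<bar>x ?T - (\<phi> ?T \<rho> + (\<Sum>i = 1..k. \<epsilon> ^ i * averaged y i \<rho>))\<bar>
        \<le> real n * C * ?T * exp (real n * L * ?T) * \<bar>\<epsilon>\<bar> ^ (k + 1)"
      by (simp add: p_def c_def z_def averaged_def)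
  qed
qed

text \<open>Periodicity of the unperturbed solution cancels order 0 and the vanishing averages
  cancel the orders below \<open>l\<close>. Orders above \<open>l\<close> are absorbed into the
  error, which is why \<epsilon> is also kept below 1.\<close>

lemma displacement_expansion:
  assumes av: "averaging_system n k \<alpha> D F \<phi> y" and \<rho>: "\<rho> \<in> D" "\<phi> 0 \<rho> = \<rho>"
    and sol: "periodic_solution n \<alpha> D (F 0) (\<lambda>\<theta>. \<phi> \<theta> \<rho>)" and ab: "{a..b} \<subseteq> D"
    and l: "l \<in> {1..k}" "\<And>s. s \<in> {1..<l} \<Longrightarrow> averaged y s \<rho> = 0"
  obtains C e where "C \<ge> 0" "e > 0" and "\<And>\<epsilon> x. \<bar>\<epsilon>\<bar> \<le> e \<Longrightarrow>
      pw_solution n \<alpha> D (perturbed_field k F R \<epsilon>) x \<Longrightarrow> x 0 = \<rho> \<Longrightarrow> (\<And>t. t \<in> {0..2 * pi} \<Longrightarrow> x t \<in> {a..b}) \<Longrightarrow>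
      \<bar>x (2 * pi) - \<rho> - \<epsilon> ^ l * averaged y l \<rho>\<bar> \<le> C * \<bar>\<epsilon>\<bar> ^ (l + 1)"
proof -
  obtain C e where Ce: "C \<ge> 0" "e > 0" "\<And>\<epsilon> x. \<bar>\<epsilon>\<bar> \<le> e \<Longrightarrow>
      pw_solution n \<alpha> D (perturbed_field k F R \<epsilon>) x \<Longrightarrow> x 0 = \<rho> \<Longrightarrow> (\<And>t. t \<in> {0..2 * pi} \<Longrightarrow> x t \<in> {a..b}) \<Longrightarrow>
      \<bar>x (2 * pi) - (\<phi> (2 * pi) \<rho> + (\<Sum>i = 1..k. \<epsilon> ^ i * averaged y i \<rho>))\<bar> \<le> C * \<bar>\<epsilon>\<bar> ^ (k + 1)"
    using sol by (auto simp: periodic_solution_def intro: solution_expansion[OF av \<rho> _ ab])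
  have \<phi>: "\<phi> (2 * pi) \<rho> = \<rho>" using sol \<rho> by (simp add: periodic_solution_def)
  show ?thesis
  proof (rule that[of "C + (\<Sum>i = l + 1..k. \<bar>averaged y i \<rho>\<bar>)" "min 1 e"])
    show "C + (\<Sum>i = l + 1..k. \<bar>averaged y i \<rho>\<bar>) \<ge> 0" using Ce by (simp add: sum_nonneg)
    show "min 1 e > 0" using Ce by simp
    fix \<epsilon> x assume \<epsilon>: "\<bar>\<epsilon>\<bar> \<le> min 1 e" and x: "pw_solution n \<alpha> D (perturbed_field k F R \<epsilon>) x" "x 0 = \<rho>"
      "\<And>t. t \<in> {0..2 * pi} \<Longrightarrow> x t \<in> {a..b}"
    have pow: "\<bar>\<epsilon>\<bar> ^ i \<le> \<bar>\<epsilon>\<bar> ^ (l + 1)" if "i \<ge> l + 1" for i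
      using \<epsilon> that by (intro power_decreasing) auto
    have "(\<Sum>i = 1..k. \<epsilon> ^ i * averaged y i \<rho>) = (\<Sum>i = l..k. \<epsilon> ^ i * averaged y i \<rho>)"
      by (rule sum.mono_neutral_right) (use l in auto)
    also have "\<dots> = \<epsilon> ^ l * averaged y l \<rho> + (\<Sum>i = l + 1..k. \<epsilon> ^ i * averaged y i \<rho>)"
      using l by (simp add: sum.atLeast_Suc_atMost)
    finally have sum: "(\<Sum>i = 1..k. \<epsilon> ^ i * averaged y i \<rho>) =
      \<epsilon> ^ l * averaged y l \<rho> + (\<Sum>i = l + 1..k. \<epsilon> ^ i * averaged y i \<rho>)" .
    have "\<bar>\<Sum>i = l + 1..k. \<epsilon> ^ i * averaged y i \<rho>\<bar> \<le> (\<Sum>i = l + 1..k. \<bar>\<epsilon>\<bar> ^ (l + 1) * \<bar>averaged y i \<rho>\<bar>)"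
      by (intro order.trans[OF sum_abs sum_mono]) (auto simp: abs_mult power_abs intro!: mult_right_mono pow[simplified])
    also have "\<dots> = (\<Sum>i = l + 1..k. \<bar>averaged y i \<rho>\<bar>) * \<bar>\<epsilon>\<bar> ^ (l + 1)"
      by (simp only: sum_distrib_left mult.commute)
    finally have 1: "\<bar>\<Sum>i = l + 1..k. \<epsilon> ^ i * averaged y i \<rho>\<bar> \<le> (\<Sum>i = l + 1..k. \<bar>averaged y i \<rho>\<bar>) * \<bar>\<epsilon>\<bar> ^ (l + 1)" .
    have "\<bar>x (2 * pi) - (\<phi> (2 * pi) \<rho> + (\<Sum>i = 1..k. \<epsilon> ^ i * averaged y i \<rho>))\<bar> \<le> C * \<bar>\<epsilon>\<bar> ^ (k + 1)"
      by (rule Ce(3)) (use \<epsilon> x in auto)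
    also have "\<dots> \<le> C * \<bar>\<epsilon>\<bar> ^ (l + 1)"
      using Ce(1) l by (intro mult_left_mono pow) auto
    finally show "\<bar>x (2 * pi) - \<rho> - \<epsilon> ^ l * averaged y l \<rho>\<bar> \<le> (C + (\<Sum>i = l + 1..k. \<bar>averaged y i \<rho>\<bar>)) * \<bar>\<epsilon>\<bar> ^ (l + 1)"
      using 1 unfolding sum \<phi> distrib_right by linarith
  qed
qed

text \<open>
  Solutions are found by clamping the field to a compact neighbourhood of the unperturbed orbit, which
  makes it globally Lipschitz; for small \<open>\<epsilon>\<close> the clamp is never active.
\<close>

lemma solution_family:
  assumes sol: "pw_solution n \<alpha> D (F 0) c"
  obtains a b \<delta> e where "{a..b} \<subseteq> D" "\<delta> > 0" "e > 0"
    and "\<And>\<epsilon>. \<bar>\<epsilon>\<bar> \<le> e \<Longrightarrow> \<exists>X. (\<forall>\<rho>\<in>{c 0 - \<delta>..c 0 + \<delta>}.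
        pw_solution n \<alpha> D (perturbed_field k F R \<epsilon>) (X \<rho>) \<and> X \<rho> 0 = \<rho> \<and> (\<forall>t\<in>{0..2 * pi}. X \<rho> t \<in> {a..b})) \<and>
        continuous_on {c 0 - \<delta>..c 0 + \<delta>} (\<lambda>\<rho>. X \<rho> (2 * pi))"
proof -
  let ?T = "2 * pi"
  have c_cont: "continuous_on {0..?T} c" and cD: "c ` {0..?T} \<subseteq> D"
    using sol by (auto simp: pw_solution_def)
  have K: "compact (c ` {0..?T})" "c ` {0..?T} \<noteq> {}"
    using c_cont by (auto intro!: compact_continuous_image)
  obtain a b \<eta> where \<eta>: "\<eta> > 0" and ab: "{a..b} \<subseteq> D"
    and near: "\<And>x. x \<in> c ` {0..?T} \<Longrightarrow> {x - \<eta>..x + \<eta>} \<subseteq> {a..b}"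
    by (rule compact_interval_neighbourhood[OF open_D interval_D K cD], rule that)
  have c_ab: "c s \<in> {a..b}" if "s \<in> {0..?T}" for s
    using near[of "c s"] that \<eta> by force
  then have "a \<le> b" by force
  obtain L where L: "L \<ge> 0"
    "\<And>\<epsilon> j s r r'. \<bar>\<epsilon>\<bar> \<le> \<epsilon>\<^sub>1 \<Longrightarrow> j \<in> {1..n} \<Longrightarrow> s \<in> {0..?T} \<Longrightarrow> r \<in> {a..b} \<Longrightarrow> r' \<in> {a..b} \<Longrightarrow>
      \<bar>perturbed_field k F R \<epsilon> j s r - perturbed_field k F R \<epsilon> j s r'\<bar> \<le> L * \<bar>r - r'\<bar>"
    "\<And>\<epsilon> j s r. \<bar>\<epsilon>\<bar> \<le> \<epsilon>\<^sub>1 \<Longrightarrow> j \<in> {1..n} \<Longrightarrow> s \<in> {0..?T} \<Longrightarrow> r \<in> {a..b} \<Longrightarrow>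
      \<bar>perturbed_field k F R \<epsilon> j s r - F 0 j s r\<bar> \<le> L * \<bar>\<epsilon>\<bar>"
    by (rule perturbed_field_bounds[OF ab], rule that)
  define cl where "cl r = max a (min b r)" for r
  have cl: "cl r \<in> {a..b}" for r using \<open>a \<le> b\<close> by (auto simp: cl_def)
  have cl_id: "cl r = r" if "r \<in> {a..b}" for r using that by (auto simp: cl_def)
  have cl_lip: "\<bar>cl r - cl r'\<bar> \<le> \<bar>r - r'\<bar>" for r r' by (auto simp: cl_def max_def min_def)
  have cl_cont: "continuous_on A (\<lambda>s. cl (x s))" if "continuous_on A x" for A and x :: "real \<Rightarrow> real"
    unfolding cl_def by (intro continuous_intros that)
  \<comment> \<open>\<open>M\<close> is the Gronwall amplification over one turn. The margin \<eta>
    is split evenly: \<delta> lets the initial offset use one half after amplification, and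
    \<open>e\<close> lets the perturbation of the field use the other.\<close>
  define M where "M = exp (real n * L * ?T)"
  have M: "M > 0" by (simp add: M_def)
  define \<delta> where "\<delta> = \<eta> / (2 * M)"
  define e where "e = min \<epsilon>\<^sub>1 (\<eta> / (2 * M * (real n * L * ?T + 1)))"
  have nL: "real n * L * ?T \<ge> 0" using L(1) by simp
  have "0 < \<eta> / (2 * M * (real n * L * ?T + 1))"
    using \<eta> M nL by (intro divide_pos_pos mult_pos_pos add_nonneg_pos) auto
  with \<epsilon>\<^sub>1(1) have "e > 0" unfolding e_def by (simp only: min_less_iff_conj)
  have "\<delta> > 0" "e \<le> \<epsilon>\<^sub>1" using \<eta> M by (auto simp: \<delta>_def e_def)
  have \<delta>e: "(\<delta> + real n * L * e * ?T) * M \<le> \<eta>"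
  proof -
    have "real n * L * e * ?T \<le> (real n * L * ?T + 1) * e" using \<open>e > 0\<close> by (simp add: algebra_simps)
    also have "\<dots> \<le> (real n * L * ?T + 1) * (\<eta> / (2 * M * (real n * L * ?T + 1)))"
      using nL by (intro mult_left_mono) (auto simp: e_def)
    also have "\<dots> = \<eta> / (2 * M)"
    proof -
      have "real n * L * ?T + 1 \<noteq> 0" using nL by linarith
      moreover have "A * (\<eta> / (2 * M * A)) = \<eta> / (2 * M)" if "A \<noteq> 0" for A using that by simp
      ultimately show ?thesis by blast
    qed
    finally have "(\<delta> + real n * L * e * ?T) * M \<le> (\<eta> / (2 * M) + \<eta> / (2 * M)) * M"
      using M by (intro mult_right_mono) (auto simp: \<delta>_def)
    also have "\<dots> = \<eta>" using M by simp
    finally show ?thesis .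
  qed
  have zone_cont: "continuous_on {\<alpha> (j - 1)..\<alpha> j} g" if "continuous_on {0..?T} g" "j \<in> {1..n}" for j and g :: "real \<Rightarrow> real"
    using continuous_on_subset[OF that(1) zone_subset[OF that(2)]] .
  show ?thesis
  proof (rule that[OF ab \<open>\<delta> > 0\<close> \<open>e > 0\<close>])
    fix \<epsilon> :: real assume \<epsilon>: "\<bar>\<epsilon>\<bar> \<le> e"
    then have \<epsilon>e: "\<bar>\<epsilon>\<bar> \<le> \<epsilon>\<^sub>1" using \<open>e \<le> \<epsilon>\<^sub>1\<close> by simp
    define G where "G j s r = perturbed_field k F R \<epsilon> j s (cl r)" for j s r
    have G_cont: "continuous_on {0..?T} (\<lambda>s. G j s (x s))" if "continuous_on {0..?T} x" "j \<in> {1..n}" for x j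
      unfolding G_def using that cl ab by (intro perturbed_field_continuous_on \<epsilon>e cl_cont) auto
    have G_int: "(\<lambda>s. piecewise n \<alpha> G s (x s)) integrable_on {0..?T}" if "continuous_on {0..?T} x" for x
      using that by (intro piecewise_integrable zone_cont G_cont)
    have G_lip: "\<bar>piecewise n \<alpha> G s r - piecewise n \<alpha> G s r'\<bar> \<le> real n * L * \<bar>r - r'\<bar>" if s: "s \<in> {0..?T}" for s r r'
      unfolding mult.assoc
    proof (rule piecewise_diff_le)
      fix j assume j: "j \<in> {1..n}"
      have "\<bar>G j s r - G j s r'\<bar> \<le> L * \<bar>cl r - cl r'\<bar>"
        unfolding G_def by (intro L(2) \<epsilon>e j s cl)
      also have "\<dots> \<le> L * \<bar>r - r'\<bar>" by (intro mult_left_mono cl_lip L(1))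
      finally show "\<bar>G j s r - G j s r'\<bar> \<le> L * \<bar>r - r'\<bar>" .
    qed (use L(1) in simp)
    have "\<exists>x. continuous_on {0..?T} x \<and> (\<forall>t\<in>{0..?T}. x t = \<rho> + integral {0..t} (\<lambda>s. piecewise n \<alpha> G s (x s)))" for \<rho>
      by (rule picard_integral_equation[of ?T "piecewise n \<alpha> G" "real n * L" \<rho>])
        (auto simp: G_int intro: G_lip)
    then obtain X where X_cont: "\<And>\<rho>. continuous_on {0..?T} (X \<rho>)"
      and X_eq: "\<And>\<rho> t. t \<in> {0..?T} \<Longrightarrow> X \<rho> t = \<rho> + integral {0..t} (\<lambda>s. piecewise n \<alpha> G s (X \<rho> s))"
      by metis
    have X0: "X \<rho> 0 = \<rho>" for \<rho> using X_eq[of 0 \<rho>] by simp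
    \<comment> \<open>The clamped solution already exists over the whole turn, so one comparison
      with the unperturbed orbit confines it to \<open>{a..b}\<close>, with no continuation
      argument.\<close>
    have X_ab: "X \<rho> t \<in> {a..b}" if \<rho>: "\<rho> \<in> {c 0 - \<delta>..c 0 + \<delta>}" and t: "t \<in> {0..?T}" for \<rho> t
    proof -
      have "\<bar>X \<rho> t - c t\<bar> \<le> (\<bar>\<rho> - c 0\<bar> + real n * L * \<bar>\<epsilon>\<bar> * ?T) * exp (real n * L * t)"
      proof (rule integral_equation_comparison[OF X_eq pw_solution_imp_integral_equation[OF sol] G_int[OF X_cont] _ X_cont c_cont])
        show "(\<lambda>s. piecewise n \<alpha> (F 0) s (c s)) integrable_on {0..?T}"
          using F_deriv_continuous_on[of 0 _ 0, OF _ _ _ c_cont cD]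
          by (intro piecewise_integrable zone_cont) auto
        fix s assume s: "s \<in> {0..?T}"
        have "\<bar>piecewise n \<alpha> G s (X \<rho> s) - piecewise n \<alpha> (F 0) s (c s)\<bar> \<le> real n * (L * \<bar>X \<rho> s - c s\<bar> + L * \<bar>\<epsilon>\<bar>)"
        proof (rule piecewise_diff_le)
          fix j assume j: "j \<in> {1..n}"
          have "\<bar>G j s (X \<rho> s) - G j s (c s)\<bar> \<le> L * \<bar>cl (X \<rho> s) - cl (c s)\<bar>"
            unfolding G_def by (intro L(2) \<epsilon>e j s cl)
          also have "\<dots> \<le> L * \<bar>X \<rho> s - c s\<bar>" by (intro mult_left_mono cl_lip L(1))
          moreover have "\<bar>G j s (c s) - F 0 j s (c s)\<bar> \<le> L * \<bar>\<epsilon>\<bar>"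
            unfolding G_def cl_id[OF c_ab[OF s]] by (intro L(3) \<epsilon>e j s c_ab)
          ultimately show "\<bar>G j s (X \<rho> s) - F 0 j s (c s)\<bar> \<le> L * \<bar>X \<rho> s - c s\<bar> + L * \<bar>\<epsilon>\<bar>" by linarith
        qed (use L(1) in simp)
        then show "\<bar>piecewise n \<alpha> G s (X \<rho> s) - piecewise n \<alpha> (F 0) s (c s)\<bar> \<le>
            real n * L * \<bar>X \<rho> s - c s\<bar> + real n * L * \<bar>\<epsilon>\<bar>"
          by (simp only: distrib_left mult.assoc)
      qed (use L(1) t in auto)
      also have "\<dots> \<le> (\<delta> + real n * L * e * ?T) * M"
      proof (intro mult_mono add_mono mult_right_mono mult_left_mono)
        show "exp (real n * L * t) \<le> M" unfolding M_def using t L(1) by (auto intro!: mult_left_mono)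
      qed (use \<rho> \<epsilon> L(1) \<open>\<delta> > 0\<close> \<open>e > 0\<close> in \<open>auto simp: abs_le_iff\<close>)
      finally have "\<bar>X \<rho> t - c t\<bar> \<le> \<eta>" using \<delta>e by simp
      then have "X \<rho> t \<in> {c t - \<eta>..c t + \<eta>}" by (auto simp: abs_le_iff)
      with near[of "c t"] t show ?thesis by blast
    qed
    have "pw_solution n \<alpha> D (perturbed_field k F R \<epsilon>) (X \<rho>)" if \<rho>: "\<rho> \<in> {c 0 - \<delta>..c 0 + \<delta>}" for \<rho>
    proof (rule integral_equation_imp_pw_solution)
      have XD: "X \<rho> ` {0..?T} \<subseteq> D" using X_ab[OF \<rho>] ab by blast
      then show "X \<rho> t \<in> D" if "t \<in> {0..?T}" for t using that by blast
      show "continuous_on {0..?T} (X \<rho>)" by (rule X_cont)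
      show "continuous_on {\<alpha> (j - 1)..\<alpha> j} (\<lambda>s. perturbed_field k F R \<epsilon> j s (X \<rho> s))" if "j \<in> {1..n}" for j
        by (intro zone_cont perturbed_field_continuous_on that \<epsilon>e X_cont XD)
      fix t assume t: "t \<in> {0..?T}"
      have "integral {0..t} (\<lambda>s. piecewise n \<alpha> G s (X \<rho> s)) =
          integral {0..t} (\<lambda>s. piecewise n \<alpha> (perturbed_field k F R \<epsilon>) s (X \<rho> s))"
        by (rule integral_cong) (use t in \<open>simp add: piecewise_def G_def cl_id[OF X_ab[OF \<rho>]]\<close>)
      then show "X \<rho> t = \<rho> + integral {0..t} (\<lambda>s. piecewise n \<alpha> (perturbed_field k F R \<epsilon>) s (X \<rho> s))"
        using X_eq[OF t, of \<rho>] by simp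
    qed
    \<comment> \<open>Two solutions of the same clamped equation have no defect relative to each
      other, so the comparison leaves the Lipschitz constant \<open>M\<close>.\<close>
    moreover have "continuous_on {c 0 - \<delta>..c 0 + \<delta>} (\<lambda>\<rho>. X \<rho> ?T)"
    proof (rule lipschitz_on_continuous_on[of M], rule lipschitz_onI)
      fix \<rho> \<rho>'
      have "\<bar>X \<rho> ?T - X \<rho>' ?T\<bar> \<le> (\<bar>\<rho> - \<rho>'\<bar> + 0 * ?T) * exp (real n * L * ?T)"
        by (rule integral_equation_comparison[OF X_eq X_eq G_int[OF X_cont] G_int[OF X_cont] X_cont X_cont])
          (use G_lip L(1) in auto)
      then show "dist (X \<rho> ?T) (X \<rho>' ?T) \<le> M * dist \<rho> \<rho>'"
        by (simp add: dist_real_def M_def mult.commute)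
    qed (use M in simp)
    ultimately show "\<exists>X. (\<forall>\<rho>\<in>{c 0 - \<delta>..c 0 + \<delta>}.
        pw_solution n \<alpha> D (perturbed_field k F R \<epsilon>) (X \<rho>) \<and> X \<rho> 0 = \<rho> \<and> (\<forall>t\<in>{0..?T}. X \<rho> t \<in> {a..b})) \<and>
        continuous_on {c 0 - \<delta>..c 0 + \<delta>} (\<lambda>\<rho>. X \<rho> ?T)"
      using X0 X_ab by blast
  qed
qed

end

section \<open>Periodic solutions\<close>

text \<open>
  No regularity in \<open>\<epsilon>\<close> is needed, so for each \<open>\<epsilon>\<close> one may pick an element whose distance to \<open>c\<close> is within
  \<open>\<bar>\<epsilon>\<bar>\<close> of the infimum.
\<close>

lemma almost_optimal_selection:
  fixes Q :: "real \<Rightarrow> 'a \<Rightarrow> bool" and g :: "'a \<Rightarrow> real"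
  assumes "\<And>d. d > 0 \<Longrightarrow> \<forall>\<^sub>F \<epsilon> in at 0. \<exists>x. Q \<epsilon> x \<and> \<bar>g x - c\<bar> \<le> d"
  obtains X where "\<forall>\<^sub>F \<epsilon> in at 0. Q \<epsilon> (X \<epsilon>)" and "((\<lambda>\<epsilon>. g (X \<epsilon>)) \<longlongrightarrow> c) (at 0)"
proof -
  \<comment> \<open>The infimum is meaningful only where \<open>Q \<epsilon>\<close> has a witness;
    the facts below use it only there.\<close>
  define I where "I \<epsilon> = (INF x\<in>Collect (Q \<epsilon>). \<bar>g x - c\<bar>)" for \<epsilon>
  define X where "X \<epsilon> = (SOME x. Q \<epsilon> x \<and> \<bar>g x - c\<bar> < I \<epsilon> + \<bar>\<epsilon>\<bar>)" for \<epsilon>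
  have X: "Q \<epsilon> (X \<epsilon>) \<and> \<bar>g (X \<epsilon>) - c\<bar> < d + \<bar>\<epsilon>\<bar>" if "Q \<epsilon> x" "\<bar>g x - c\<bar> \<le> d" "\<epsilon> \<noteq> 0" for \<epsilon> x d
  proof -
    have less: "Inf ((\<lambda>x. \<bar>g x - c\<bar>) ` Collect (Q \<epsilon>)) < I \<epsilon> + \<bar>\<epsilon>\<bar>" using that(3) by (simp add: I_def)
    have "(\<lambda>x. \<bar>g x - c\<bar>) ` Collect (Q \<epsilon>) \<noteq> {}" using that(1) by auto
    from cInf_lessD[OF this less] obtain x' where "Q \<epsilon> x' \<and> \<bar>g x' - c\<bar> < I \<epsilon> + \<bar>\<epsilon>\<bar>"
      by auto
    then have "Q \<epsilon> (X \<epsilon>) \<and> \<bar>g (X \<epsilon>) - c\<bar> < I \<epsilon> + \<bar>\<epsilon>\<bar>" unfolding X_def by (rule someI)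
    moreover have "I \<epsilon> \<le> \<bar>g x - c\<bar>"
      unfolding I_def by (rule cINF_lower) (use that in \<open>auto intro!: bdd_belowI2[of _ 0]\<close>)
    ultimately show ?thesis using that by linarith
  qed
  show ?thesis
  proof
    show "\<forall>\<^sub>F \<epsilon> in at 0. Q \<epsilon> (X \<epsilon>)"
      using assms[OF zero_less_one] eventually_neq_at_within[of 0 0 UNIV] by eventually_elim (use X in blast)
    show "((\<lambda>\<epsilon>. g (X \<epsilon>)) \<longlongrightarrow> c) (at 0)"
    proof (rule tendstoI)
      fix d :: real assume "d > 0"
      then have "\<forall>\<^sub>F \<epsilon> in at 0. dist \<epsilon> (0 :: real) < d / 2" by (intro tendstoD tendsto_ident_at) auto
      moreover have "\<forall>\<^sub>F \<epsilon> in at 0. \<exists>x. Q \<epsilon> x \<and> \<bar>g x - c\<bar> \<le> d / 2"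
        using \<open>d > 0\<close> by (intro assms) auto
      ultimately show "\<forall>\<^sub>F \<epsilon> in at 0. dist (g (X \<epsilon>)) c < d"
        using eventually_neq_at_within[of 0 0 UNIV]
      proof eventually_elim
        case (elim \<epsilon>)
        then show ?case using X[of \<epsilon> _ "d / 2"] by (fastforce simp: dist_real_def)
      qed
    qed
  qed
qed

text \<open>Multiplying by \<open>sgn d\<close> reduces to a positive derivative. Differentiability
  at the single point \<open>x\<close> suffices, and one step \<open>h\<close> serves both
  sides.\<close>

lemma nonzero_deriv_sign_change:
  fixes f :: "real \<Rightarrow> real"
  assumes "(f has_real_derivative d) (at x)" "d \<noteq> 0" "f x = 0" "\<delta> > 0"
  obtains h where "0 < h" "h < \<delta>" "sgn d * f (x + h) > 0" "sgn d * f (x - h) < 0"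
proof -
  define g where "g u = sgn d * f u" for u
  have g: "(g has_real_derivative \<bar>d\<bar>) (at x)"
    unfolding g_def using assms(1) by (auto intro!: derivative_eq_intros simp: abs_sgn)
  have d: "\<bar>d\<bar> > 0" using assms(2) by simp
  obtain h1 where h1: "h1 > 0" "\<forall>h>0. h < h1 \<longrightarrow> g x < g (x + h)"
    using DERIV_pos_inc_right[OF g d] by auto
  obtain h2 where h2: "h2 > 0" "\<forall>h>0. h < h2 \<longrightarrow> g (x - h) < g x"
    using DERIV_pos_inc_left[OF g d] by auto
  define h where "h = min \<delta> (min h1 h2) / 2"
  have "0 < h" "h < \<delta>" "h < h1" "h < h2" using h1(1) h2(1) \<open>\<delta> > 0\<close> by (auto simp: h_def)
  with h1(2) h2(2) show ?thesis using assms(3) by (intro that[of h]) (auto simp: g_def)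
qed

text \<open>The step \<open>h\<close> is fixed before \<epsilon>, so the pointwise expansion is
  applied at two radii only. At both, the term of order \<open>l\<close> dominates the error for
  small \<epsilon>, and opposite signs of the displacement enclose a fixed point of the return
  map.\<close>

lemma (in piecewise_perturbation) periodic_solutions_near_simple_zero:
  assumes av: "averaging_system n k \<alpha> D F \<phi> y"
    and unperturbed: "\<And>\<rho>. \<rho> \<in> D \<Longrightarrow> \<phi> 0 \<rho> = \<rho> \<and> periodic_solution n \<alpha> D (F 0) (\<lambda>\<theta>. \<phi> \<theta> \<rho>)"
    and l: "l \<in> {1..k}" "\<And>s \<rho>. s \<in> {1..<l} \<Longrightarrow> \<rho> \<in> D \<Longrightarrow> averaged y s \<rho> = 0"
    and \<rho>: "\<rho> \<in> D" "averaged y l \<rho> = 0"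
    and d: "(averaged y l has_real_derivative d) (at \<rho>)" "d \<noteq> 0" and "\<eta> > 0"
  shows "\<forall>\<^sub>F \<epsilon> in at 0. \<exists>x. periodic_solution n \<alpha> D (perturbed_field k F R \<epsilon>) x \<and> \<bar>x 0 - \<rho>\<bar> \<le> \<eta>"
proof -
  have \<phi>: "\<phi> 0 \<rho> = \<rho>" "pw_solution n \<alpha> D (F 0) (\<lambda>\<theta>. \<phi> \<theta> \<rho>)"
    using unperturbed[OF \<rho>(1)] by (auto simp: periodic_solution_def)
  obtain a b \<delta> e where ab: "{a..b} \<subseteq> D" and "\<delta> > 0" "e > 0"
    and X_ex: "\<And>\<epsilon>. \<bar>\<epsilon>\<bar> \<le> e \<Longrightarrow> \<exists>X. (\<forall>\<rho>'\<in>{\<rho> - \<delta>..\<rho> + \<delta>}.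
        pw_solution n \<alpha> D (perturbed_field k F R \<epsilon>) (X \<rho>') \<and> X \<rho>' 0 = \<rho>' \<and> (\<forall>t\<in>{0..2 * pi}. X \<rho>' t \<in> {a..b})) \<and>
        continuous_on {\<rho> - \<delta>..\<rho> + \<delta>} (\<lambda>\<rho>'. X \<rho>' (2 * pi))"
    by (rule solution_family[OF \<phi>(2), unfolded \<phi>(1)], rule that)
  obtain h where h: "0 < h" "h < min \<delta> \<eta>"
    and sign: "sgn d * averaged y l (\<rho> + h) > 0" "sgn d * averaged y l (\<rho> - h) < 0"
    by (rule nonzero_deriv_sign_change[OF d \<rho>(2), of "min \<delta> \<eta>"]) (use \<open>\<delta> > 0\<close> \<open>\<eta> > 0\<close> in auto)
  have expansion: "\<exists>C e. C \<ge> 0 \<and> e > 0 \<and> (\<forall>\<epsilon> x. \<bar>\<epsilon>\<bar> \<le> e \<longrightarrow>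
      pw_solution n \<alpha> D (perturbed_field k F R \<epsilon>) x \<longrightarrow> x 0 = \<rho>' \<longrightarrow> (\<forall>t\<in>{0..2 * pi}. x t \<in> {a..b}) \<longrightarrow>
      \<bar>x (2 * pi) - \<rho>' - \<epsilon> ^ l * averaged y l \<rho>'\<bar> \<le> C * \<bar>\<epsilon>\<bar> ^ (l + 1))" if "\<rho>' \<in> D" for \<rho>'
    by (rule displacement_expansion[OF av that _ _ ab l(1)]) (use unperturbed[OF that] l(2) that in blast)+
  \<comment> \<open>Both radii are initial values of solutions confined to \<open>{a..b}\<close>;
    the family at \<epsilon> = 0 already shows this.\<close>
  have D: "\<rho> - h \<in> D" "\<rho> + h \<in> D"
  proof -
    obtain X where X: "\<And>\<rho>'. \<rho>' \<in> {\<rho> - \<delta>..\<rho> + \<delta>} \<Longrightarrow> X \<rho>' 0 = \<rho>' \<and> X \<rho>' 0 \<in> {a..b}"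
      using X_ex[of 0] \<open>e > 0\<close> by fastforce
    show "\<rho> - h \<in> D" "\<rho> + h \<in> D" using X[of "\<rho> - h"] X[of "\<rho> + h"] h ab by auto
  qed
  obtain C1 e1 where 1: "C1 \<ge> 0" "e1 > 0" "\<And>\<epsilon> x. \<bar>\<epsilon>\<bar> \<le> e1 \<Longrightarrow>
      pw_solution n \<alpha> D (perturbed_field k F R \<epsilon>) x \<Longrightarrow> x 0 = \<rho> + h \<Longrightarrow> (\<forall>t\<in>{0..2 * pi}. x t \<in> {a..b}) \<Longrightarrow>
      \<bar>x (2 * pi) - (\<rho> + h) - \<epsilon> ^ l * averaged y l (\<rho> + h)\<bar> \<le> C1 * \<bar>\<epsilon>\<bar> ^ (l + 1)"
    using expansion[OF D(2)] by blast
  obtain C2 e2 where 2: "C2 \<ge> 0" "e2 > 0" "\<And>\<epsilon> x. \<bar>\<epsilon>\<bar> \<le> e2 \<Longrightarrow>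
      pw_solution n \<alpha> D (perturbed_field k F R \<epsilon>) x \<Longrightarrow> x 0 = \<rho> - h \<Longrightarrow> (\<forall>t\<in>{0..2 * pi}. x t \<in> {a..b}) \<Longrightarrow>
      \<bar>x (2 * pi) - (\<rho> - h) - \<epsilon> ^ l * averaged y l (\<rho> - h)\<bar> \<le> C2 * \<bar>\<epsilon>\<bar> ^ (l + 1)"
    using expansion[OF D(1)] by blast
  define v1 v2 where "v1 = sgn d * averaged y l (\<rho> + h)" and "v2 = - (sgn d * averaged y l (\<rho> - h))"
  have v: "v1 > 0" "v2 > 0" using sign by (auto simp: v1_def v2_def)
  \<comment> \<open>Below \<open>v / (C + 1)\<close> the error
    \<open>C * \<bar>\<epsilon>\<bar> ^ (l + 1)\<close> is smaller than the leading term
    \<open>\<bar>\<epsilon>\<bar> ^ l * v\<close>; the added 1 covers \<open>C = 0\<close>.\<close>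
  define e' where "e' = Min {e, e1, e2, v1 / (C1 + 1), v2 / (C2 + 1)}"
  have e': "e' > 0" "e' \<le> e" "e' \<le> e1" "e' \<le> e2" "e' \<le> v1 / (C1 + 1)" "e' \<le> v2 / (C2 + 1)"
    using \<open>e > 0\<close> 1 2 v by (auto simp: e'_def)
  have ex: "\<exists>x. periodic_solution n \<alpha> D (perturbed_field k F R \<epsilon>) x \<and> \<bar>x 0 - \<rho>\<bar> \<le> \<eta>"
    if \<epsilon>: "\<epsilon> \<noteq> 0" "\<bar>\<epsilon>\<bar> < e'" for \<epsilon>
  proof -
    have "\<bar>\<epsilon>\<bar> \<le> e" using \<epsilon> e' by simp
    from X_ex[OF this] obtain X where "\<forall>\<rho>'\<in>{\<rho> - \<delta>..\<rho> + \<delta>}. pw_solution n \<alpha> D (perturbed_field k F R \<epsilon>) (X \<rho>') \<and>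
        X \<rho>' 0 = \<rho>' \<and> (\<forall>t\<in>{0..2 * pi}. X \<rho>' t \<in> {a..b})"
      and X_cont: "continuous_on {\<rho> - \<delta>..\<rho> + \<delta>} (\<lambda>\<rho>'. X \<rho>' (2 * pi))"
      by blast
    note X = bspec[OF this(1)]
    \<comment> \<open>Absorbs the sign of the derivative and that of \<open>\<epsilon> ^ l\<close>,
      which is negative for odd \<open>l\<close> and negative \<epsilon>; all cases then share one
      orientation of the intermediate value theorem.\<close>
    define \<sigma> where "\<sigma> = sgn d * sgn (\<epsilon> ^ l)"
    have \<sigma>: "\<bar>\<sigma>\<bar> = 1" using d(2) \<epsilon>(1) by (simp add: \<sigma>_def abs_mult abs_sgn_eq power_abs)
    have \<sigma>_eq: "\<sigma> * (\<epsilon> ^ l * u) = \<bar>\<epsilon>\<bar> ^ l * (sgn d * u)" for u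
    proof -
      have "sgn (\<epsilon> ^ l) * \<epsilon> ^ l = \<bar>\<epsilon>\<bar> ^ l"
        unfolding power_abs [symmetric] abs_sgn [of "\<epsilon> ^ l"] by (rule mult.commute)
      then show ?thesis by (simp add: \<sigma>_def ac_simps)
    qed
    have small: "C * \<bar>\<epsilon>\<bar> ^ (l + 1) < \<bar>\<epsilon>\<bar> ^ l * v" if "C \<ge> 0" "e' \<le> v / (C + 1)" for C v
    proof -
      have "C * \<bar>\<epsilon>\<bar> \<le> (C + 1) * \<bar>\<epsilon>\<bar>" by (simp add: algebra_simps)
      also have "\<dots> < (C + 1) * (v / (C + 1))" using \<epsilon>(2) that by (intro mult_strict_left_mono) auto
      also have "\<dots> = v" using that by simp
      finally have "\<bar>\<epsilon>\<bar> ^ l * (C * \<bar>\<epsilon>\<bar>) < \<bar>\<epsilon>\<bar> ^ l * v" using \<epsilon>(1) by (intro mult_strict_left_mono) auto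
      then show ?thesis by (simp add: ac_simps)
    qed
    have \<sigma>_le: "\<bar>\<sigma> * u - \<sigma> * w\<bar> = \<bar>u - w\<bar>" for u w
      unfolding right_diff_distrib [symmetric] abs_mult \<sigma> by simp
    have "\<bar>X (\<rho> + h) (2 * pi) - (\<rho> + h) - \<epsilon> ^ l * averaged y l (\<rho> + h)\<bar> \<le> C1 * \<bar>\<epsilon>\<bar> ^ (l + 1)"
      by (rule 1(3)) (use X[of "\<rho> + h"] h \<epsilon> e' in auto)
    then have "\<bar>\<sigma> * (X (\<rho> + h) (2 * pi) - (\<rho> + h)) - \<bar>\<epsilon>\<bar> ^ l * v1\<bar> \<le> C1 * \<bar>\<epsilon>\<bar> ^ (l + 1)"
      unfolding v1_def \<sigma>_eq [symmetric] \<sigma>_le .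
    then have pos: "\<sigma> * (X (\<rho> + h) (2 * pi) - (\<rho> + h)) \<ge> 0"
      using small[OF 1(1) e'(5)] by linarith
    have "\<bar>X (\<rho> - h) (2 * pi) - (\<rho> - h) - \<epsilon> ^ l * averaged y l (\<rho> - h)\<bar> \<le> C2 * \<bar>\<epsilon>\<bar> ^ (l + 1)"
      by (rule 2(3)) (use X[of "\<rho> - h"] h \<epsilon> e' in auto)
    then have "\<bar>\<sigma> * (X (\<rho> - h) (2 * pi) - (\<rho> - h)) - \<bar>\<epsilon>\<bar> ^ l * (- v2)\<bar> \<le> C2 * \<bar>\<epsilon>\<bar> ^ (l + 1)"
      unfolding v2_def minus_minus \<sigma>_eq [symmetric] \<sigma>_le .
    then have neg: "\<sigma> * (X (\<rho> - h) (2 * pi) - (\<rho> - h)) \<le> 0"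
      using small[OF 2(1) e'(6)] by linarith
    have "\<exists>\<rho>'. \<rho> - h \<le> \<rho>' \<and> \<rho>' \<le> \<rho> + h \<and> \<sigma> * (X \<rho>' (2 * pi) - \<rho>') = 0"
    proof (rule IVT'[where f = "\<lambda>\<rho>'. \<sigma> * (X \<rho>' (2 * pi) - \<rho>')", OF neg pos])
      show "\<rho> - h \<le> \<rho> + h" using h by simp
      show "continuous_on {\<rho> - h..\<rho> + h} (\<lambda>\<rho>'. \<sigma> * (X \<rho>' (2 * pi) - \<rho>'))"
        by (intro continuous_intros continuous_on_subset[OF X_cont]) (use h in auto)
    qed
    then obtain \<rho>' where \<rho>': "\<rho>' \<in> {\<rho> - h..\<rho> + h}" "X \<rho>' (2 * pi) = \<rho>'"
      using \<sigma> by auto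
    moreover have "\<rho>' \<in> {\<rho> - \<delta>..\<rho> + \<delta>}" using \<rho>'(1) h by auto
    ultimately have "periodic_solution n \<alpha> D (perturbed_field k F R \<epsilon>) (X \<rho>')" "\<bar>X \<rho>' 0 - \<rho>\<bar> \<le> \<eta>"
      using X[of \<rho>'] h by (auto simp: periodic_solution_def abs_le_iff)
    then show ?thesis by blast
  qed
  show ?thesis
    unfolding eventually_at using e'(1) ex by (auto simp: dist_real_def)
qed

theorem theorem1:
  fixes n k l :: nat
    and \<alpha> :: "nat \<Rightarrow> real"
    and D :: "real set"
    and \<epsilon>\<^sub>0 :: real
    and F :: "nat \<Rightarrow> nat \<Rightarrow> real \<Rightarrow> real \<Rightarrow> real"
    and R :: "nat \<Rightarrow> real \<Rightarrow> real \<Rightarrow> real \<Rightarrow> real"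
    and \<phi> :: "real \<Rightarrow> real \<Rightarrow> real"
    and y :: "nat \<Rightarrow> real \<Rightarrow> real \<Rightarrow> real"
    and \<rho>star d :: real
  assumes "n > 1" and "k \<ge> 1"
    and "\<alpha> 0 = 0" and "\<alpha> n = 2 * pi" and "\<And>j. j < n \<Longrightarrow> \<alpha> j < \<alpha> (Suc j)"
    and "open D" and "is_interval D" and "bounded D" and "D \<subseteq> {0..}"
    and "\<epsilon>\<^sub>0 > 0"
    and F_Ck: "\<And>i j. i \<le> k \<Longrightarrow> j \<in> {1..n} \<Longrightarrow> Ck (k + 1) (\<lambda>(\<theta>, r). F i j \<theta> r) (UNIV \<times> D)"
    and F_periodic: "\<And>i j \<theta> r. i \<le> k \<Longrightarrow> j \<in> {1..n} \<Longrightarrow> r \<in> D \<Longrightarrow> F i j (\<theta> + 2 * pi) r = F i j \<theta> r"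
    and R_Ck: "\<And>j. j \<in> {1..n} \<Longrightarrow>
          Ck (k + 1) (\<lambda>(\<theta>, r, \<epsilon>). R j \<theta> r \<epsilon>) (UNIV \<times> D \<times> {-\<epsilon>\<^sub>0<..<\<epsilon>\<^sub>0})"
    and R_periodic: "\<And>j \<theta> r \<epsilon>. j \<in> {1..n} \<Longrightarrow> r \<in> D \<Longrightarrow> \<epsilon> \<in> {-\<epsilon>\<^sub>0<..<\<epsilon>\<^sub>0} \<Longrightarrow>
          R j (\<theta> + 2 * pi) r \<epsilon> = R j \<theta> r \<epsilon>"
    and unperturbed: "\<And>\<rho>. \<rho> \<in> D \<Longrightarrow> \<phi> 0 \<rho> = \<rho> \<and> periodic_solution n \<alpha> D (F 0) (\<lambda>\<theta>. \<phi> \<theta> \<rho>)"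
    and crossing: "\<And>\<rho> j. \<rho> \<in> D \<Longrightarrow> j < n \<Longrightarrow> crossing_point n \<alpha> (F 0) j (\<phi> (\<alpha> j) \<rho>)"
    and averaging: "averaging_system n k \<alpha> D F \<phi> y"
    and "l \<in> {1..k}"
    and "\<And>s \<rho>. s \<in> {1..<l} \<Longrightarrow> \<rho> \<in> D \<Longrightarrow> averaged y s \<rho> = 0"
    and "\<exists>\<rho>\<in>D. averaged y l \<rho> \<noteq> 0"
    and "\<rho>star \<in> D" and "averaged y l \<rho>star = 0"
    and "(averaged y l has_real_derivative d) (at \<rho>star)" and "d \<noteq> 0"
  shows "\<exists>r :: real \<Rightarrow> real \<Rightarrow> real.
           (\<forall>\<^sub>F \<epsilon> in at 0.
              periodic_solution n \<alpha> D (perturbed_field k F R \<epsilon>) (\<lambda>\<theta>. r \<theta> \<epsilon>)) \<and>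
           ((\<lambda>\<epsilon>. r 0 \<epsilon>) \<longlongrightarrow> \<rho>star) (at 0)"
proof -
  interpret piecewise_perturbation n \<alpha> k D \<epsilon>\<^sub>0 F R
    by unfold_locales (fact assms)+
  obtain X where "\<forall>\<^sub>F \<epsilon> in at 0. periodic_solution n \<alpha> D (perturbed_field k F R \<epsilon>) (X \<epsilon>)"
    and "((\<lambda>\<epsilon>. X \<epsilon> 0) \<longlongrightarrow> \<rho>star) (at 0)"
  \<comment> \<open>Here \<open>g\<close> is evaluation at angle 0. The selection merges the
    thresholds for the individual \<eta> into one family whose initial values converge.\<close>
  proof (rule almost_optimal_selection)
    fix \<eta> :: real assume "\<eta> > 0"
    show "\<forall>\<^sub>F \<epsilon> in at 0. \<exists>x. periodic_solution n \<alpha> D (perturbed_field k F R \<epsilon>) x \<and> \<bar>x 0 - \<rho>star\<bar> \<le> \<eta>"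
      by (rule periodic_solutions_near_simple_zero[where l = l and d = d and \<phi> = \<phi> and y = y])
        (fact assms \<open>\<eta> > 0\<close>)+
  qed
  then show ?thesis by (intro exI[of _ "\<lambda>\<theta> \<epsilon>. X \<epsilon> \<theta>"]) simp
qed

end
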